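(* Let $n\ge1$ be an integer. There is a constant $\beta_n>1$ depending only on $n$ with the following property. Let $R>0$ be arbitrary and let $g:(R,\infty)\times\mathbb{R}\to\mathbb{R}$ be a $C^1$ function with $g(r,0)\equiv0$ on $(R,\infty)$ and $\partial_ug(r,u)\ge0$ on $(R,\infty)\times[0,\infty)$. When $\psi,\widetilde\psi:(R,\infty)\to\mathbb{R}$ are continuous functions such that $\psi\ge\widetilde\psi\ge0$, let $u$ denote the solution, in the class described in the context, of $$\partial_t^2u-\partial_r^2u-\frac{n-1}{r}\,\partial_ru=g(r,u)\ \text{ in }\Theta_T,\qquad u(r,0)=0,\quad\partial_tu(r,0)=\psi(r)\ \text{ in }(R,\infty),$$ and let $\widetilde u$ denote the solution of the same problem with $\psi$ replaced by $\widetilde\psi$. Then $$u\ge\widetilde u\ge0\quad\text{in }\Theta_T'=\{(r,t)\in\mathbb{R}_+^2: r>\max(\beta_nt,\,t+R),\ 0\le t<T\},$$ where $T$ denotes the lifespan of $u$.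
   Context: $\mathbb{R}_+=(0,\infty)$ and, for $R,T>0$, $\Theta_T=\{(r,t)\in\mathbb{R}_+^2: r>t+R,\ 0\le t<T\}$. Solutions are required to be continuous, locally bounded and of locally finite energy in $\Theta_T$, namely such that $u\in L^\infty_{\rm loc}(\Theta_T)$ and $r^{(n-1)/2}(|u|+|\partial_ru|+|\partial_tu|)\in L^2_{\rm loc}(\Theta_T)$. For each such $g$ and each continuous initial datum, there exist some $T>0$ and a unique such solution in $\Theta_T$. The lifespan of a solution is the supremum of the times $T$ for which it exists in $\Theta_T$. *)

theory Defs
  imports "HOL-Analysis.Analysis"
begin

text \<open>Points of the half-plane are pairs \<open>(r, t)\<close>. Times \<open>T\<close> are extended reals, so that
  infinite lifespans are covered.\<close>

definition Theta :: "real \<Rightarrow> ereal \<Rightarrow> (real \<times> real) set" where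
  "Theta R T = {(r, t). t + R < r \<and> 0 \<le> t \<and> ereal t < T}"

definition Theta' :: "real \<Rightarrow> real \<Rightarrow> ereal \<Rightarrow> (real \<times> real) set" where
  "Theta' \<beta> R T = {(r, t). max (\<beta> * t) (t + R) < r \<and> 0 \<le> t \<and> ereal t < T}"

definition C1_on :: "('a::real_normed_vector \<Rightarrow> 'b::real_normed_vector) \<Rightarrow> 'a set \<Rightarrow> bool" where
  "C1_on f S \<longleftrightarrow> (\<exists>f'. (\<forall>x\<in>S. (f has_derivative blinfun_apply (f' x)) (at x)) \<and> continuous_on S f')"

definition pd_r :: "(real \<times> real \<Rightarrow> real) \<Rightarrow> real \<times> real \<Rightarrow> real" where
  "pd_r f = (\<lambda>(r, t). deriv (\<lambda>s. f (s, t)) r)"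

definition pd_t :: "(real \<times> real \<Rightarrow> real) \<Rightarrow> real \<times> real \<Rightarrow> real" where
  "pd_t f = (\<lambda>(r, t). deriv (\<lambda>s. f (r, s)) t)"

text \<open>\<open>f\<close> is \<open>C\<^sup>\<infinity>\<close> on the plane: \<open>D i j\<close> is the continuous mixed partial derivative of order
  \<open>i\<close> in \<open>r\<close> and \<open>j\<close> in \<open>t\<close>.\<close>

definition smooth_plane :: "(real \<times> real \<Rightarrow> real) \<Rightarrow> bool" where
  "smooth_plane f \<longleftrightarrow> (\<exists>D :: nat \<Rightarrow> nat \<Rightarrow> real \<times> real \<Rightarrow> real. D 0 0 = f \<and>
     (\<forall>i j. continuous_on UNIV (D i j) \<and>
       (\<forall>r t. ((\<lambda>s. D i j (s, t)) has_real_derivative D (Suc i) j (r, t)) (at r) \<and>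
              ((\<lambda>s. D i j (r, s)) has_real_derivative D i (Suc j) (r, t)) (at t))))"

definition test_functions :: "(real \<times> real) set \<Rightarrow> (real \<times> real \<Rightarrow> real) set" where
  "test_functions S = {\<phi>. smooth_plane \<phi> \<and> compact (closure {x. \<phi> x \<noteq> 0}) \<and> closure {x. \<phi> x \<noteq> 0} \<subseteq> S}"

text \<open>Local conditions refer to compact subsets of the given set; for \<open>Theta R T\<close>, these may
  touch the initial line \<open>t = 0\<close>.\<close>

definition Linf_loc :: "(real \<times> real) set \<Rightarrow> (real \<times> real \<Rightarrow> real) \<Rightarrow> bool" where
  "Linf_loc S f \<longleftrightarrow> (\<forall>K. compact K \<and> K \<subseteq> S \<longrightarrow>
     set_borel_measurable lborel K f \<and> (\<exists>B. AE x\<in>K in lborel. \<bar>f x\<bar> \<le> B))"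

definition L1_loc :: "(real \<times> real) set \<Rightarrow> (real \<times> real \<Rightarrow> real) \<Rightarrow> bool" where
  "L1_loc S f \<longleftrightarrow> (\<forall>K. compact K \<and> K \<subseteq> S \<longrightarrow> set_integrable lborel K f)"

definition L2_loc :: "(real \<times> real) set \<Rightarrow> (real \<times> real \<Rightarrow> real) \<Rightarrow> bool" where
  "L2_loc S f \<longleftrightarrow> (\<forall>K. compact K \<and> K \<subseteq> S \<longrightarrow>
     set_borel_measurable lborel K f \<and> set_integrable lborel K (\<lambda>x. (f x)\<^sup>2))"

definition weak_pd_r :: "(real \<times> real) set \<Rightarrow> (real \<times> real \<Rightarrow> real) \<Rightarrow> (real \<times> real \<Rightarrow> real) \<Rightarrow> bool" where
  "weak_pd_r U f h \<longleftrightarrow> L1_loc U f \<and> L1_loc U h \<and>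
     (\<forall>\<phi>\<in>test_functions U.
        (LINT x:U|lborel. f x * pd_r \<phi> x) = - (LINT x:U|lborel. h x * \<phi> x))"

definition weak_pd_t :: "(real \<times> real) set \<Rightarrow> (real \<times> real \<Rightarrow> real) \<Rightarrow> (real \<times> real \<Rightarrow> real) \<Rightarrow> bool" where
  "weak_pd_t U f h \<longleftrightarrow> L1_loc U f \<and> L1_loc U h \<and>
     (\<forall>\<phi>\<in>test_functions U.
        (LINT x:U|lborel. f x * pd_t \<phi> x) = - (LINT x:U|lborel. h x * \<phi> x))"

text \<open>Solutions of the Cauchy problem
  \<open>u\<^sub>t\<^sub>t - u\<^sub>r\<^sub>r - (n-1)/r u\<^sub>r = g(r, u)\<close> in \<open>Theta R T\<close>, \<open>u(r,0) = 0\<close>, \<open>u\<^sub>t(r,0) = \<psi>(r)\<close>.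
  The equation holds in the sense of distributions, and the test functions \<open>\<phi>\<close> need not vanish on
  the initial line: one integration by parts of \<open>u\<^sub>t\<^sub>t \<phi>\<close> in \<open>t\<close> and of \<open>u\<^sub>r\<^sub>r \<phi>\<close> in \<open>r\<close> produces
  the boundary term with \<open>\<psi>\<close>, which encodes the condition on \<open>u\<^sub>t(r,0)\<close>.\<close>

definition is_solution ::
  "nat \<Rightarrow> real \<Rightarrow> (real \<times> real \<Rightarrow> real) \<Rightarrow> (real \<Rightarrow> real) \<Rightarrow> ereal \<Rightarrow> (real \<times> real \<Rightarrow> real) \<Rightarrow> bool" where
  "is_solution n R g \<psi> T u \<longleftrightarrow>
     continuous_on (Theta R T) u \<and> Linf_loc (Theta R T) u \<and>
     (\<forall>r>R. u (r, 0) = 0) \<and>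
     (\<exists>ur ut.
        weak_pd_r (interior (Theta R T)) u ur \<and> weak_pd_t (interior (Theta R T)) u ut \<and>
        L2_loc (Theta R T)
          (\<lambda>(r, t). r powr ((real n - 1) / 2) * (\<bar>u (r, t)\<bar> + \<bar>ur (r, t)\<bar> + \<bar>ut (r, t)\<bar>)) \<and>
        (\<forall>\<phi>\<in>test_functions (Theta R T \<union> {(r, t). t < 0}).
           (LINT (r, t):interior (Theta R T)|lborel.
              - ut (r, t) * pd_t \<phi> (r, t) + ur (r, t) * pd_r \<phi> (r, t)
              - (real n - 1) / r * ur (r, t) * \<phi> (r, t)) =
           (LINT (r, t):interior (Theta R T)|lborel. g (r, u (r, t)) * \<phi> (r, t)) +
           (LINT r:{R<..}|lborel. \<psi> r * \<phi> (r, 0))))"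

text \<open>Solutions in \<open>Theta R T\<close> are unique, so the lifespan is determined by the data.\<close>

definition lifespan ::
  "nat \<Rightarrow> real \<Rightarrow> (real \<times> real \<Rightarrow> real) \<Rightarrow> (real \<Rightarrow> real) \<Rightarrow> ereal" where
  "lifespan n R g \<psi> = Sup (ereal ` {T. 0 < T \<and> (\<exists>u. is_solution n R g \<psi> (ereal T) u)})"

end

theory Submission
  imports Defs
begin

text \<open>Put \<open>\<alpha> = (n-1)/2\<close> and \<open>c = \<alpha>(\<alpha>-1)\<close>. The weighted function \<open>v = r\<^sup>\<alpha> u\<close> satisfies the
  one-dimensional equation \<open>v\<^sub>t\<^sub>t - v\<^sub>r\<^sub>r + c v / r\<^sup>2 = r\<^sup>\<alpha> g(r, u)\<close>, so that the formula of
  d'Alembert turns the problem into an integral equation on backward characteristic triangles: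
  \<open>2 v(P)\<close> is the integral of \<open>r\<^sup>\<alpha> \<psi>\<close> over the base plus the integral of \<open>r\<^sup>\<alpha> g(r, u) - c v / r\<^sup>2\<close>
  over the triangle below \<open>P\<close> (\<open>dalembert_formula\<close>).

  For a weak solution this formula is the limit of the weak equation for test functions
  \<open>r\<^sup>\<alpha> a(r-t) b(r+t)\<close>, where \<open>a\<close> and \<open>b\<close> are smooth approximations of step functions at the two
  characteristics through \<open>P\<close>: the wave operator maps \<open>a(r-t) b(r+t)\<close> to \<open>-4 a'(r-t) b'(r+t)\<close>, an
  approximate point mass at \<open>P\<close>, and \<open>a(r-t) b(r+t)\<close> itself tends to the indicator function of the
  triangle. The derivatives that fall on \<open>u\<close> in the weak equation are moved to the test function
  first (\<open>weak_form_powr_weight\<close>). The test functions do not vanish at \<open>t = 0\<close>, but the boundary terms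
  disappear because \<open>u(r, 0) = 0\<close>.

  In the integral equation, only the positive part \<open>\<kappa> = max 0 c\<close> of the potential works against
  positivity. The idea of \<open>cone_positivity\<close> is that the contribution \<open>H\<close> of the data and of the positive
  part of the nonlinearity grows with the triangle. Hence \<open>v\<close> is bounded above on the whole triangle
  below \<open>P\<close> by \<open>H(P)\<close> plus a term that involves only the negative part of \<open>v\<close>, and the potential
  takes away at most that bound times the integral of \<open>\<kappa> / r\<^sup>2\<close> over the triangle, divided by \<open>2\<close>. In a
  conic region \<open>r > \<beta> t\<close> with \<open>\<beta>\<close> large this factor is at most \<open>1\<close>, so \<open>H\<close> cannot be used up.
  What remains bounds the negative part of \<open>v\<close> by a multiple of its own integral over the triangle,
  and a Gronwall argument (\<open>cone_gronwall\<close>) shows that it vanishes. The nonlinearity enters only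
  through the bound from below by the negative part, which follows from its monotonicity on
  \<open>[0, \<infinity>)\<close> and its local Lipschitz continuity.

  This argument is applied to each of the two solutions, with the nonlinear term \<open>g(r, u) - g(r, 0)\<close>,
  and then, once both are known to be nonnegative, to their difference.\<close>

section \<open>Families of mixed partial derivatives\<close>

text \<open>The condition in \<open>smooth_plane\<close>, localised to a set \<open>U\<close> and with the family of derivatives as the
  object: products and powers of \<open>r\<close> are handled on an open set first, and extended by zero later.\<close>

definition smooth_family :: "(real \<times> real) set \<Rightarrow> (nat \<Rightarrow> nat \<Rightarrow> real \<times> real \<Rightarrow> real) \<Rightarrow> bool" where
  "smooth_family U D \<longleftrightarrow> (\<forall>i j. continuous_on U (D i j) \<and>
     (\<forall>r t. (r, t) \<in> U \<longrightarrow>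
        ((\<lambda>s. D i j (s, t)) has_real_derivative D (Suc i) j (r, t)) (at r) \<and>
        ((\<lambda>s. D i j (r, s)) has_real_derivative D i (Suc j) (r, t)) (at t)))"

lemma smooth_plane_iff: "smooth_plane f \<longleftrightarrow> (\<exists>D. D 0 0 = f \<and> smooth_family UNIV D)"
  by (simp add: smooth_plane_def smooth_family_def)

lemma smooth_familyD:
  assumes "smooth_family U D"
  shows "continuous_on U (D i j)"
    and "(r, t) \<in> U \<Longrightarrow> ((\<lambda>s. D i j (s, t)) has_real_derivative D (Suc i) j (r, t)) (at r)"
    and "(r, t) \<in> U \<Longrightarrow> ((\<lambda>s. D i j (r, s)) has_real_derivative D i (Suc j) (r, t)) (at t)"
  using assms unfolding smooth_family_def by blast+

lemma smooth_family_subset: "smooth_family U D \<Longrightarrow> V \<subseteq> U \<Longrightarrow> smooth_family V D"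
  unfolding smooth_family_def by (meson continuous_on_subset subsetD)

lemma smooth_family_shift_r: "smooth_family U D \<Longrightarrow> smooth_family U (\<lambda>i. D (Suc i))"
  unfolding smooth_family_def by blast

lemma smooth_family_shift_t: "smooth_family U D \<Longrightarrow> smooth_family U (\<lambda>i j. D i (Suc j))"
  unfolding smooth_family_def by blast

text \<open>The Leibniz rule without binomial coefficients: the first index is unfolded by moving one derivative
  to either factor, and when it is used up, the second one is. Since differentiation acts on families
  by an index shift, the recursion runs over shifted families.\<close>

fun leibniz :: "nat \<Rightarrow> nat \<Rightarrow> (nat \<Rightarrow> nat \<Rightarrow> real \<times> real \<Rightarrow> real) \<Rightarrow>
    (nat \<Rightarrow> nat \<Rightarrow> real \<times> real \<Rightarrow> real) \<Rightarrow> real \<times> real \<Rightarrow> real" where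
  "leibniz 0 0 D E = (\<lambda>x. D 0 0 x * E 0 0 x)"
| "leibniz 0 (Suc j) D E = (\<lambda>x. leibniz 0 j (\<lambda>i j. D i (Suc j)) E x + leibniz 0 j D (\<lambda>i j. E i (Suc j)) x)"
| "leibniz (Suc i) j D E = (\<lambda>x. leibniz i j (\<lambda>i. D (Suc i)) E x + leibniz i j D (\<lambda>i. E (Suc i)) x)"

lemma leibniz_00_deriv:
  assumes "smooth_family U D" "smooth_family U E" "(r, t) \<in> U"
  shows "((\<lambda>s. leibniz 0 0 D E (s, t)) has_real_derivative leibniz (Suc 0) 0 D E (r, t)) (at r)"
    and "((\<lambda>s. leibniz 0 0 D E (r, s)) has_real_derivative leibniz 0 (Suc 0) D E (r, t)) (at t)"
  using DERIV_mult[OF smooth_familyD(2)[OF assms(1,3), of 0 0] smooth_familyD(2)[OF assms(2,3), of 0 0]]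
    DERIV_mult[OF smooth_familyD(3)[OF assms(1,3), of 0 0] smooth_familyD(3)[OF assms(2,3), of 0 0]]
  by (simp_all add: algebra_simps)

text \<open>Here and below, the induction is over all pairs of families at once, because each step of the recursion
  replaces one of the two families by its shift.\<close>

lemma leibniz_deriv_r:
  assumes "smooth_family U D" "smooth_family U E" "(r, t) \<in> U"
  shows "((\<lambda>s. leibniz i j D E (s, t)) has_real_derivative leibniz (Suc i) j D E (r, t)) (at r)"
  using assms
proof (induction i arbitrary: D E)
  case (Suc i)
  show ?case
    using DERIV_add[OF Suc.IH[OF smooth_family_shift_r[OF Suc.prems(1)] Suc.prems(2,3)]
      Suc.IH[OF Suc.prems(1) smooth_family_shift_r[OF Suc.prems(2)] Suc.prems(3)]]
    by simp
next
  case 0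
  then show ?case
  proof (induction j arbitrary: D E)
    case 0
    then show ?case using leibniz_00_deriv(1) by blast
  next
    case (Suc j)
    show ?case
      using DERIV_add[OF Suc.IH[OF smooth_family_shift_t[OF Suc.prems(1)] Suc.prems(2,3)]
        Suc.IH[OF Suc.prems(1) smooth_family_shift_t[OF Suc.prems(2)] Suc.prems(3)]]
      by (simp add: algebra_simps)
  qed
qed

lemma leibniz_deriv_t:
  assumes "smooth_family U D" "smooth_family U E" "(r, t) \<in> U"
  shows "((\<lambda>s. leibniz i j D E (r, s)) has_real_derivative leibniz i (Suc j) D E (r, t)) (at t)"
  using assms
proof (induction i arbitrary: D E)
  case (Suc i)
  show ?case
    using DERIV_add[OF Suc.IH[OF smooth_family_shift_r[OF Suc.prems(1)] Suc.prems(2,3)]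
      Suc.IH[OF Suc.prems(1) smooth_family_shift_r[OF Suc.prems(2)] Suc.prems(3)]]
    by simp
next
  case 0
  then show ?case
  proof (induction j arbitrary: D E)
    case 0
    then show ?case using leibniz_00_deriv(2) by blast
  next
    case (Suc j)
    show ?case
      using DERIV_add[OF Suc.IH[OF smooth_family_shift_t[OF Suc.prems(1)] Suc.prems(2,3)]
        Suc.IH[OF Suc.prems(1) smooth_family_shift_t[OF Suc.prems(2)] Suc.prems(3)]]
      by simp
  qed
qed

lemma leibniz_continuous:
  assumes "smooth_family U D" "smooth_family U E"
  shows "continuous_on U (leibniz i j D E)"
  using assms
proof (induction i arbitrary: D E)
  case (Suc i)
  then show ?case using smooth_family_shift_r by (auto intro!: continuous_on_add)
next
  case 0
  then show ?case
  proof (induction j arbitrary: D E)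
    case 0
    then show ?case using smooth_familyD(1) by (auto intro!: continuous_on_mult)
  next
    case (Suc j)
    then show ?case using smooth_family_shift_t by (auto intro!: continuous_on_add)
  qed
qed

lemma smooth_family_mult:
  assumes "smooth_family U D" "smooth_family U E"
  shows "smooth_family U (\<lambda>i j. leibniz i j D E)"
  unfolding smooth_family_def
  using leibniz_continuous[OF assms] leibniz_deriv_r[OF assms] leibniz_deriv_t[OF assms] by blast

lemma open_slices:
  fixes U :: "(real \<times> real) set"
  assumes "open U" "(r, t) \<in> U"
  shows "eventually (\<lambda>s. (s, t) \<in> U) (nhds r)" "eventually (\<lambda>s. (r, s) \<in> U) (nhds t)"
proof -
  have "open {s. (s, t) \<in> U}" "open {s. (r, s) \<in> U}"
    using open_vimage[OF assms(1), of "\<lambda>s. (s, t)"] open_vimage[OF assms(1), of "\<lambda>s. (r, s)"]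
    by (simp_all add: vimage_def continuous_on_Pair)
  then show "eventually (\<lambda>s. (s, t) \<in> U) (nhds r)" "eventually (\<lambda>s. (r, s) \<in> U) (nhds t)"
    using assms(2) by (auto simp: eventually_nhds)
qed

lemma smooth_family_cong:
  assumes "open U" "smooth_family U D" "\<And>i j x. x \<in> U \<Longrightarrow> E i j x = D i j x"
  shows "smooth_family U E"
  unfolding smooth_family_def
proof (intro allI conjI impI)
  fix i j r t
  show "continuous_on U (E i j)"
    using smooth_familyD(1)[OF assms(2), of i j] assms(3) by (metis continuous_on_cong)
  assume rt: "(r, t) \<in> U"
  have "eventually (\<lambda>s. E i j (s, t) = D i j (s, t)) (nhds r)"
    by (rule eventually_mono[OF open_slices(1)[OF assms(1) rt]]) (rule assms(3))
  from DERIV_cong_ev[OF refl this assms(3)[OF rt]]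
  show "((\<lambda>s. E i j (s, t)) has_real_derivative E (Suc i) j (r, t)) (at r)"
    using smooth_familyD(2)[OF assms(2) rt] by simp
  have "eventually (\<lambda>s. E i j (r, s) = D i j (r, s)) (nhds t)"
    by (rule eventually_mono[OF open_slices(2)[OF assms(1) rt]]) (rule assms(3))
  from DERIV_cong_ev[OF refl this assms(3)[OF rt]]
  show "((\<lambda>s. E i j (r, s)) has_real_derivative E i (Suc j) (r, t)) (at t)"
    using smooth_familyD(3)[OF assms(2) rt] by simp
qed

lemma smooth_family_union:
  assumes "open U" "open V" "smooth_family U D" "smooth_family V D"
  shows "smooth_family (U \<union> V) D"
  using assms unfolding smooth_family_def by (auto intro!: continuous_on_open_Un)

text \<open>On an open set, a function that vanishes identically has vanishing derivatives, and the family records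
  exactly these.\<close>

lemma smooth_family_zero:
  assumes "open U" "smooth_family U D" "\<And>x. x \<in> U \<Longrightarrow> D 0 0 x = 0"
  shows "\<forall>x\<in>U. D i j x = 0"
proof -
  have step: "\<forall>x\<in>U. D (Suc i) j x = 0" "\<forall>x\<in>U. D i (Suc j) x = 0" if z: "\<forall>x\<in>U. D i j x = 0" for i j
  proof -
    have "D (Suc i) j (r, t) = 0 \<and> D i (Suc j) (r, t) = 0" if rt: "(r, t) \<in> U" for r t
    proof -
      have "eventually (\<lambda>s. D i j (s, t) = 0) (nhds r)" "eventually (\<lambda>s. D i j (r, s) = 0) (nhds t)"
        by (rule eventually_mono[OF open_slices(1)[OF assms(1) rt]], use z in blast)
          (rule eventually_mono[OF open_slices(2)[OF assms(1) rt]], use z in blast)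
      then have "((\<lambda>s. D i j (s, t)) has_real_derivative 0) (at r)"
        "((\<lambda>s. D i j (r, s)) has_real_derivative 0) (at t)"
        by (simp_all add: DERIV_cong_ev[OF refl _ refl])
      then show ?thesis
        using DERIV_unique[OF smooth_familyD(2)[OF assms(2) rt]]
          DERIV_unique[OF smooth_familyD(3)[OF assms(2) rt]] by blast
    qed
    then show "\<forall>x\<in>U. D (Suc i) j x = 0" "\<forall>x\<in>U. D i (Suc j) x = 0" by auto
  qed
  have 0: "\<forall>x\<in>U. D 0 j x = 0"
    by (induction j) (use assms(3) step in auto)
  show ?thesis
    by (induction i) (use 0 step in auto)
qed

text \<open>The zero extension is smooth because the open sets \<open>U\<close> and \<open>- S\<close> cover the plane, and on \<open>- S\<close>
  all members of the extended family are zero.\<close>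

lemma smooth_plane_extend:
  assumes "open U" "smooth_family U D" "closed S" "S \<subseteq> U"
    and "\<And>x. x \<in> U \<Longrightarrow> f x = D 0 0 x" and "\<And>x. x \<notin> S \<Longrightarrow> f x = 0"
  shows "smooth_plane f"
proof -
  define E where "E i j x = (if x \<in> U then D i j x else 0)" for i j x
  have 1: "smooth_family U E"
    by (rule smooth_family_cong[OF assms(1,2)]) (simp add: E_def)
  have "\<forall>x\<in>U - S. D i j x = 0" for i j
  proof (rule smooth_family_zero)
    show "open (U - S)" using assms(1,3) by (rule open_Diff)
    show "smooth_family (U - S) D" using assms(2) by (rule smooth_family_subset) blast
    show "D 0 0 x = 0" if "x \<in> U - S" for x
      using that assms(5)[of x] assms(6)[of x] by simp
  qed
  then have z: "E i j x = 0" if "x \<in> - S" for i j x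
    using that by (auto simp: E_def)
  have "smooth_family (- S) (\<lambda>i j x. 0)" by (simp add: smooth_family_def)
  then have 2: "smooth_family (- S) E"
    by (rule smooth_family_cong[OF open_Compl[OF assms(3)]]) (rule z)
  have "smooth_family (U \<union> - S) E"
    using 1 2 assms by (intro smooth_family_union) auto
  moreover have "U \<union> - S = UNIV" using assms by auto
  moreover have "E 0 0 = f"
  proof
    show "E 0 0 x = f x" for x
      using assms(4) assms(5)[of x] assms(6)[of x] unfolding E_def by (cases "x \<in> U") auto
  qed
  ultimately show ?thesis unfolding smooth_plane_iff by (intro exI[of _ E]) simp
qed

lemma smooth_plane_mult:
  assumes "smooth_plane f" "smooth_plane h" shows "smooth_plane (\<lambda>x. f x * h x)"
proof -
  obtain D E where D: "D 0 0 = f" "smooth_family UNIV D" and E: "E 0 0 = h" "smooth_family UNIV E"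
    using assms unfolding smooth_plane_iff by blast
  show ?thesis unfolding smooth_plane_iff
    by (intro exI[of _ "\<lambda>i j. leibniz i j D E"] conjI smooth_family_mult D(2) E(2)) (simp add: D(1) E(1))
qed

lemma smooth_plane_cmult: "smooth_plane f \<Longrightarrow> smooth_plane (\<lambda>x. c * f x)"
proof -
  assume "smooth_plane f"
  then obtain D where D: "D 0 0 = f" "smooth_family UNIV D" unfolding smooth_plane_iff by blast
  have "smooth_family UNIV (\<lambda>i j x. c * D i j x)"
    using D(2) unfolding smooth_family_def
    by (auto intro!: continuous_intros DERIV_cmult)
  then show ?thesis unfolding smooth_plane_iff using D(1) by (intro exI[of _ "\<lambda>i j x. c * D i j x"]) auto
qed

lemma smooth_plane_diff:
  assumes "smooth_plane f" "smooth_plane h" shows "smooth_plane (\<lambda>x. f x - h x)"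
proof -
  obtain D E where D: "D 0 0 = f" "smooth_family UNIV D" and E: "E 0 0 = h" "smooth_family UNIV E"
    using assms unfolding smooth_plane_iff by blast
  have "smooth_family UNIV (\<lambda>i j x. D i j x - E i j x)"
    using D(2) E(2) unfolding smooth_family_def
    by (auto intro!: continuous_intros DERIV_diff)
  then show ?thesis unfolding smooth_plane_iff using D(1) E(1)
    by (intro exI[of _ "\<lambda>i j x. D i j x - E i j x"]) auto
qed

text \<open>The coefficient is the falling factorial of \<open>\<alpha>\<close>, as \<open>\<alpha>\<close> need not be an integer.\<close>

lemma smooth_family_powr:
  "smooth_family {x. 0 < fst x}
     (\<lambda>i j x. if j = 0 then (\<Prod>k<i. \<alpha> - real k) * fst x powr (\<alpha> - real i) else 0)"
  unfolding smooth_family_def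
proof (intro allI conjI impI)
  fix i j :: nat and r t :: real
  show "continuous_on {x. 0 < fst x}
    (\<lambda>x::real\<times>real. if j = 0 then (\<Prod>k<i. \<alpha> - real k) * fst x powr (\<alpha> - real i) else 0)"
    by (cases "j = 0") (auto intro!: continuous_intros)
  assume "(r, t) \<in> {x. 0 < fst x}"
  then show "((\<lambda>s. if j = 0 then (\<Prod>k<i. \<alpha> - real k) * fst (s, t) powr (\<alpha> - real i) else 0)
    has_real_derivative
      (if j = 0 then (\<Prod>k<Suc i. \<alpha> - real k) * fst (r, t) powr (\<alpha> - real (Suc i)) else 0)) (at r)"
    by (cases "j = 0") (auto intro!: derivative_eq_intros simp: algebra_simps)
  show "((\<lambda>s. if j = 0 then (\<Prod>k<i. \<alpha> - real k) * fst (r, s) powr (\<alpha> - real i) else 0)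
    has_real_derivative
      (if Suc j = 0 then (\<Prod>k<i. \<alpha> - real k) * fst (r, t) powr (\<alpha> - real i) else 0)) (at t)"
    by (cases "j = 0") simp_all
qed

text \<open>The weight \<open>r\<^sup>\<alpha>\<close> is smooth only for \<open>r > 0\<close>; a factor with support there makes the product
  smooth on the plane.\<close>

lemma smooth_plane_powr_mult:
  assumes "smooth_plane f" "closure {x. f x \<noteq> 0} \<subseteq> {x. 0 < fst x}"
  shows "smooth_plane (\<lambda>x. fst x powr \<alpha> * f x)"
proof -
  obtain D where D: "D 0 0 = f" "smooth_family UNIV D" using assms(1) unfolding smooth_plane_iff by blast
  show ?thesis
  proof (rule smooth_plane_extend)
    show "open {x::real\<times>real. 0 < fst x}" by (intro open_Collect_less continuous_intros)
    show "smooth_family {x. 0 < fst x} (\<lambda>i j. leibniz i j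
        (\<lambda>i j x. if j = 0 then (\<Prod>k<i. \<alpha> - real k) * fst x powr (\<alpha> - real i) else 0) D)"
      by (intro smooth_family_mult smooth_family_powr smooth_family_subset[OF D(2)]) simp
    show "fst x powr \<alpha> * f x = 0" if "x \<notin> closure {x. f x \<noteq> 0}" for x
      using that closure_subset[of "{x. f x \<noteq> 0}"] by auto
  qed (use assms(2) D(1) in simp_all)
qed

definition smooth_line :: "(nat \<Rightarrow> real \<Rightarrow> real) \<Rightarrow> bool" where
  "smooth_line d \<longleftrightarrow> (\<forall>k x. (d k has_real_derivative d (Suc k) x) (at x))"

lemma smooth_line_continuous: "smooth_line d \<Longrightarrow> continuous_on S (d k)"
  unfolding smooth_line_def by (meson DERIV_continuous_on has_field_derivative_at_within)

lemma smooth_plane_affine: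
  assumes "smooth_line d"
  shows "smooth_plane (\<lambda>x. d 0 (c + p * fst x + q * snd x))"
proof -
  have d: "(d k has_real_derivative d (Suc k) x) (at x)" for k x
    using assms by (simp add: smooth_line_def)
  have "smooth_family UNIV (\<lambda>i j x. p ^ i * q ^ j * d (i + j) (c + p * fst x + q * snd x))"
    unfolding smooth_family_def
  proof (intro allI conjI impI)
    fix i j :: nat and r t :: real
    show "continuous_on UNIV (\<lambda>x. p ^ i * q ^ j * d (i + j) (c + p * fst x + q * snd x))"
      by (intro continuous_intros continuous_on_compose2[OF smooth_line_continuous[OF assms, of UNIV]]) auto
    have "((\<lambda>s. d (i + j) (c + p * s + q * t)) has_real_derivative d (Suc (i + j)) (c + p * r + q * t) * p) (at r)"
      by (rule DERIV_chain2[OF d]) (auto intro!: derivative_eq_intros)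
    from DERIV_cmult[OF this, of "p ^ i * q ^ j"]
    show "((\<lambda>s. p ^ i * q ^ j * d (i + j) (c + p * fst (s, t) + q * snd (s, t))) has_real_derivative
      p ^ Suc i * q ^ j * d (Suc i + j) (c + p * fst (r, t) + q * snd (r, t))) (at r)"
      by (simp add: ac_simps)
    have "((\<lambda>s. d (i + j) (c + p * r + q * s)) has_real_derivative d (Suc (i + j)) (c + p * r + q * t) * q) (at t)"
      by (rule DERIV_chain2[OF d]) (auto intro!: derivative_eq_intros)
    from DERIV_cmult[OF this, of "p ^ i * q ^ j"]
    show "((\<lambda>s. p ^ i * q ^ j * d (i + j) (c + p * fst (r, s) + q * snd (r, s))) has_real_derivative
      p ^ i * q ^ Suc j * d (i + Suc j) (c + p * fst (r, t) + q * snd (r, t))) (at t)"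
      by (simp add: ac_simps)
  qed
  then show ?thesis unfolding smooth_plane_iff
    by (intro exI[of _ "\<lambda>i j x. p ^ i * q ^ j * d (i + j) (c + p * fst x + q * snd x)"]) auto
qed

section \<open>A smooth step function\<close>

lemma poly_exp_tendsto_0:
  fixes p :: "real poly"
  shows "((\<lambda>y. y ^ k * poly p y * exp (- y)) \<longlongrightarrow> 0) at_top"
proof (induction p arbitrary: k)
  case 0
  then show ?case by simp
next
  case (pCons a p)
  have "((\<lambda>y. a * (y ^ k / exp y) + y ^ Suc k * poly p y * exp (- y)) \<longlongrightarrow> a * 0 + 0) at_top"
    by (intro tendsto_intros tendsto_power_div_exp_0 pCons.IH)
  then show ?case by (simp add: algebra_simps exp_minus divide_inverse)
qed

text \<open>For \<open>x > 0\<close>, each derivative of \<open>exp (- 1/x)\<close> is a polynomial in \<open>1/x\<close> times \<open>exp (- 1/x)\<close>, and this is the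
  recursion for the polynomials.\<close>

fun flat_poly :: "nat \<Rightarrow> real poly" where
  "flat_poly 0 = 1"
| "flat_poly (Suc k) = monom 1 2 * (flat_poly k - pderiv (flat_poly k))"

definition flat :: "nat \<Rightarrow> real \<Rightarrow> real" where
  "flat k x = (if x \<le> 0 then 0 else poly (flat_poly k) (1 / x) * exp (- (1 / x)))"

lemma flat_quotient_tendsto_0: "((\<lambda>x. flat k x / x) \<longlongrightarrow> 0) (at 0)"
proof -
  have "filterlim (\<lambda>x::real. 1 / x) at_top (at_right 0)"
    by (simp add: filterlim_inverse_at_top_right divide_inverse)
  then have "((\<lambda>x. (1 / x) ^ 1 * poly (flat_poly k) (1 / x) * exp (- (1 / x))) \<longlongrightarrow> 0) (at_right 0)"
    by (rule filterlim_compose[OF poly_exp_tendsto_0])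
  moreover have "eventually (\<lambda>x. (1 / x) ^ 1 * poly (flat_poly k) (1 / x) * exp (- (1 / x)) = flat k x / x)
      (at_right 0)"
    by (auto simp: eventually_at_filter flat_def)
  ultimately have "((\<lambda>x. flat k x / x) \<longlongrightarrow> 0) (at_right 0)"
    using tendsto_cong by fast
  moreover have "eventually (\<lambda>x. 0 = flat k x / x) (at_left 0)"
    by (auto simp: eventually_at_filter flat_def)
  then have "((\<lambda>x. flat k x / x) \<longlongrightarrow> 0) (at_left 0)"
    using tendsto_cong tendsto_const by fast
  ultimately show ?thesis by (simp add: filterlim_split_at)
qed

text \<open>Only \<open>x = 0\<close> is delicate: there the difference quotient tends to \<open>0\<close>, since the exponential beats
  every polynomial in \<open>1/x\<close>.\<close>

lemma smooth_line_flat: "smooth_line flat"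
  unfolding smooth_line_def
proof (intro allI)
  fix k x
  consider "x < 0" | "x = 0" | "x > (0::real)" by linarith
  then show "(flat k has_real_derivative flat (Suc k) x) (at x)"
  proof cases
    case 1
    then have "eventually (\<lambda>y. flat k y = 0) (nhds x)"
      using eventually_nhds_in_open[of "{..<0}" x] by (auto elim!: eventually_mono simp: flat_def)
    from DERIV_cong_ev[OF refl this refl]
    have "(flat k has_real_derivative 0) (at x)" by simp
    with 1 show ?thesis by (simp add: flat_def)
  next
    case 2
    then show ?thesis
      using flat_quotient_tendsto_0[of k] by (simp add: DERIV_def flat_def)
  next
    case 3
    have "((\<lambda>y. poly (flat_poly k) (1 / y) * exp (- (1 / y))) has_real_derivative flat (Suc k) x) (at x)"
      using 3
      by (auto intro!: derivative_eq_intros DERIV_chain2[OF poly_DERIV]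
          simp: flat_def poly_monom field_simps power2_eq_square)
    moreover have "eventually (\<lambda>y. flat k y = poly (flat_poly k) (1 / y) * exp (- (1 / y))) (nhds x)"
      using eventually_nhds_in_open[of "{0<..}" x] 3 by (auto elim!: eventually_mono simp: flat_def)
    ultimately show ?thesis using DERIV_cong_ev[OF refl _ refl] by fast
  qed
qed

text \<open>\<open>H k\<close> is the \<open>k\<close>-th derivative of a smooth monotone transition from \<open>0\<close> to \<open>1\<close> over \<open>[0, 1]\<close>.\<close>

definition smooth_step :: "(nat \<Rightarrow> real \<Rightarrow> real) \<Rightarrow> bool" where
  "smooth_step H \<longleftrightarrow> smooth_line H \<and> (\<forall>x\<le>0. H 0 x = 0) \<and> (\<forall>x\<ge>1. H 0 x = 1) \<and>
     (\<forall>x. 0 \<le> H 0 x \<and> H 0 x \<le> 1) \<and> (\<forall>x. 0 \<le> H (Suc 0) x) \<and>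
     (\<forall>x. x \<le> 0 \<or> 1 \<le> x \<longrightarrow> H (Suc 0) x = 0)"

text \<open>The step is the normalised integral of the bump \<open>flat 0 x * flat 0 (1 - x)\<close>. The derivatives of the
  bump are read off from a function of two variables, for which the product rule is available.\<close>

lemma smooth_step_exists: "\<exists>H. smooth_step H"
proof -
  have "smooth_plane (\<lambda>x. flat 0 (0 + 1 * fst x + 0 * snd x) * flat 0 (1 + (-1) * fst x + 0 * snd x))"
    by (intro smooth_plane_mult smooth_plane_affine smooth_line_flat)
  then obtain D where D: "D 0 0 = (\<lambda>x. flat 0 (0 + 1 * fst x + 0 * snd x) * flat 0 (1 + (-1) * fst x + 0 * snd x))"
    "smooth_family UNIV D" unfolding smooth_plane_iff by blast
  define d where "d k x = D k 0 (x, 0)" for k and x :: real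
  have d: "(d k has_real_derivative d (Suc k) x) (at x)" for k x
    unfolding d_def by (rule smooth_familyD(2)[OF D(2)]) simp
  have d0: "d 0 x = flat 0 x * flat 0 (1 - x)" for x by (simp add: d_def D(1))
  have dpos: "0 < d 0 x \<longleftrightarrow> 0 < x \<and> x < 1" and dz: "x \<le> 0 \<or> 1 \<le> x \<Longrightarrow> d 0 x = 0" for x
    by (auto simp: d0 flat_def)
  have dnn: "0 \<le> d 0 x" for x using dpos[of x] dz[of x] by linarith
  have dc: "continuous_on S (d 0)" for S
    by (meson DERIV_continuous_on d has_field_derivative_at_within)
  have dint: "d 0 integrable_on {a..b}" for a b
    using dc integrable_continuous_interval by blast
  \<comment> \<open>With the lower limit \<open>-1\<close>, the point \<open>0\<close> is interior, and the derivative of \<open>I\<close> there is two-sided.\<close>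
  define I where "I x = integral {-1..x} (d 0)" for x
  have Iz: "I x = 0" if "x \<le> 0" for x
    using integral_spike[of "{}" "{-1..x}" "\<lambda>_. 0" "d 0"] that dz by (simp add: I_def)
  have I': "(I has_real_derivative d 0 x) (at x)" for x
  proof (cases "x < 0")
    case True
    then have "eventually (\<lambda>y. I y = 0) (nhds x)"
      using eventually_nhds_in_open[of "{..<0}" x] by (auto elim!: eventually_mono simp: Iz)
    from DERIV_cong_ev[OF refl this refl] True show ?thesis by (simp add: dz)
  next
    case False
    have "(I has_real_derivative d 0 x) (at x within {-1..x+1})"
      unfolding I_def by (rule integral_has_real_derivative) (use False dc in auto)
    moreover have "x \<in> interior {-1..x+1}" using False by simp
    ultimately show ?thesis by (metis at_within_interior)
  qed
  have Iconst: "I x = I 1" if "1 \<le> x" for x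
  proof -
    have "integral {-1..1} (d 0) + integral {1..x} (d 0) = integral {-1..x} (d 0)"
      by (rule Henstock_Kurzweil_Integration.integral_combine) (use that dint in auto)
    moreover have "integral {1..x} (d 0) = 0"
      using integral_spike[of "{}" "{1..x}" "\<lambda>_. 0" "d 0"] dz by simp
    ultimately show ?thesis by (simp add: I_def)
  qed
  have Imono: "mono I"
    by (rule monoI) (use DERIV_nonneg_imp_nondecreasing I' dnn in blast)
  \<comment> \<open>Otherwise \<open>I\<close> would be constant on \<open>[0, 1]\<close>, although the bump is positive at \<open>1/2\<close>.\<close>
  have I1: "0 < I 1"
  proof (rule ccontr)
    assume "\<not> 0 < I 1"
    then have z: "I x = 0" if "x \<in> {0..1}" for x
      using monoD[OF Imono, of 0 x] monoD[OF Imono, of x 1] Iz[of 0] that by force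
    have "eventually (\<lambda>y. I y = 0) (nhds (1/2))"
      using eventually_nhds_in_open[of "{0<..<1}" "1/2::real"] by (auto elim!: eventually_mono intro!: z)
    from DERIV_cong_ev[OF refl this refl] have "(I has_real_derivative 0) (at (1/2))" by simp
    then have "d 0 (1/2) = 0" using DERIV_unique[OF I'] by blast
    then show False using dpos[of "1/2"] by simp
  qed
  define H where "H k x = (case k of 0 \<Rightarrow> I x | Suc j \<Rightarrow> d j x) / I 1" for k x
  show ?thesis
  proof (rule exI[of _ H], unfold smooth_step_def, intro conjI allI impI)
    show "smooth_line H"
      unfolding smooth_line_def
    proof (intro allI)
      show "(H k has_real_derivative H (Suc k) x) (at x)" for k x
        unfolding H_def by (cases k) (auto intro!: DERIV_cdivide I' d)
    qed
    show "H 0 x = 0" if "x \<le> 0" for x using Iz[OF that] by (simp add: H_def)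
    show "H 0 x = 1" if "1 \<le> x" for x using Iconst[OF that] I1 by (simp add: H_def)
    show "0 \<le> H 0 x" for x
      using monoD[OF Imono, of 0 x] Iz[of 0] Iz[of x] I1 by (cases "x \<le> 0") (auto simp: H_def)
    show "H 0 x \<le> 1" for x
      using monoD[OF Imono, of x 1] Iconst[of x] I1 by (cases "x \<le> 1") (auto simp: H_def)
    show "0 \<le> H (Suc 0) x" for x using dnn I1 by (simp add: H_def)
    show "H (Suc 0) x = 0" if "x \<le> 0 \<or> 1 \<le> x" for x using dz[OF that] by (simp add: H_def)
  qed
qed

section \<open>Cutting off near the initial line\<close>

definition Omega :: "real \<Rightarrow> ereal \<Rightarrow> (real \<times> real) set" where
  "Omega R T = {(r, t). t + R < r \<and> 0 < t \<and> ereal t < T}"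

lemma Omega_iff: "x \<in> Omega R T \<longleftrightarrow> snd x + R < fst x \<and> 0 < snd x \<and> ereal (snd x) < T"
  by (cases x) (simp add: Omega_def)

lemma Theta_iff: "x \<in> Theta R T \<longleftrightarrow> snd x + R < fst x \<and> 0 \<le> snd x \<and> ereal (snd x) < T"
  by (cases x) (simp add: Theta_def)

lemma open_Omega: "open (Omega R T)"
proof -
  have "Omega R T = {x. snd x + R < fst x} \<inter> {x. 0 < snd x} \<inter> {x. ereal (snd x) < T}"
    by (auto simp: Omega_iff)
  moreover have "open {x::real\<times>real. ereal (snd x) < T}"
    by (intro open_Collect_less continuous_intros)
  ultimately show ?thesis
    by (auto intro!: open_Int open_Collect_less continuous_intros)
qed

lemma Omega_subset_Theta: "Omega R T \<subseteq> Theta R T"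
  by (auto simp: Omega_def Theta_def)

lemma interior_Theta: "interior (Theta R T) = Omega R T"
proof
  show "Omega R T \<subseteq> interior (Theta R T)"
    using open_Omega Omega_subset_Theta by (rule interior_maximal[rotated])
  show "interior (Theta R T) \<subseteq> Omega R T"
  proof
    fix x assume x: "x \<in> interior (Theta R T)"
    then have "x \<in> Theta R T" using interior_subset by blast
    moreover have "snd x \<noteq> 0"
    proof
      assume 0: "snd x = 0"
      obtain d where d: "0 < d" "ball x d \<subseteq> Theta R T"
        using x unfolding mem_interior by blast
      have "(fst x, - d / 2) \<in> ball x d"
        using d(1) 0 by (cases x) (simp add: dist_Pair_Pair dist_real_def)
      then have "(fst x, - d / 2) \<in> Theta R T" using d(2) by blast
      then show False using d(1) by (simp add: Theta_def)
    qed
    ultimately show "x \<in> Omega R T" by (auto simp: Omega_iff Theta_iff)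
  qed
qed

lemma integral_abs_le_measure:
  fixes f :: "'a \<Rightarrow> real"
  assumes "\<And>x. \<bar>f x\<bar> \<le> c * indicator S x" "S \<in> sets M" "emeasure M S < \<infinity>" "0 \<le> c"
  shows "\<bar>integral\<^sup>L M f\<bar> \<le> c * measure M S"
\<comment> \<open>The integral of a function that is not integrable is \<open>0\<close> by convention.\<close>
proof (cases "integrable M f")
  case True
  have "norm (integral\<^sup>L M f) \<le> integral\<^sup>L M (\<lambda>x. norm (f x))" by (rule integral_norm_bound)
  also have "\<dots> \<le> integral\<^sup>L M (\<lambda>x. c * indicator S x)"
    using True assms by (intro integral_mono integrable_norm integrable_mult_right integrable_real_indicator) auto
  also have "\<dots> = c * measure M S" using assms by simp
  finally show ?thesis by simp
next
  case False
  then have "integral\<^sup>L M f = 0" by (rule not_integrable_integral_eq)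
  then show ?thesis using assms(4) by simp
qed

context
  fixes R :: real and T :: ereal and K :: "(real \<times> real) set"
  assumes K: "compact K" "K \<subseteq> Theta R T"
begin

lemma continuous_bounded_on_compact:
  fixes f :: "real \<times> real \<Rightarrow> real"
  assumes "continuous_on (Theta R T) f"
  obtains B where "0 < B" "\<And>x. x \<in> K \<Longrightarrow> \<bar>f x\<bar> \<le> B"
proof -
  have "bounded (f ` K)"
    using K assms by (meson compact_continuous_image compact_imp_bounded continuous_on_subset)
  then show ?thesis using that by (auto simp: bounded_pos)
qed

lemma compact_above: "0 < e \<Longrightarrow> compact (K \<inter> {x. e \<le> snd x})" "0 < e \<Longrightarrow> K \<inter> {x. e \<le> snd x} \<subseteq> Omega R T"
proof -
  have "closed {x::real\<times>real. e \<le> snd x}" by (intro closed_Collect_le continuous_intros)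
  then show "compact (K \<inter> {x. e \<le> snd x})" using K by (intro compact_Int_closed)
  show "0 < e \<Longrightarrow> K \<inter> {x. e \<le> snd x} \<subseteq> Omega R T"
    using K by (auto simp: Omega_iff Theta_iff subset_iff)
qed

text \<open>The factor \<open>H 0 (m t - 1)\<close> vanishes for \<open>t \<le> 1/m\<close> and equals \<open>1\<close> for \<open>t \<ge> 2/m\<close>. It turns a test
  function that reaches the initial line into one with compact support in the interior, and disappears
  as \<open>m \<rightarrow> \<infinity>\<close> by dominated convergence. The function \<open>h\<close> is one of \<open>u\<close>, \<open>u\<^sub>r\<close>, \<open>u\<^sub>t\<close>, about
  which local integrability is known only in the interior; the dominating function \<open>w\<close> on \<open>K\<close> comes from
  the locally finite energy.\<close>

lemma cutoff_integral_limit: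
  fixes h \<zeta> w :: "real \<times> real \<Rightarrow> real"
  assumes H: "smooth_step H"
    and h: "L1_loc (Omega R T) h" and w: "set_integrable lborel K w"
    and hw: "\<And>x. x \<in> K \<Longrightarrow> \<bar>h x\<bar> \<le> w x"
    and \<zeta>: "continuous_on (Theta R T) \<zeta>" "\<And>x. x \<in> Omega R T - K \<Longrightarrow> \<zeta> x = 0"
  shows "set_integrable lborel (Omega R T) (\<lambda>x. h x * \<zeta> x)"
    and "(\<lambda>m. LINT x:Omega R T|lborel. h x * (\<zeta> x * H 0 (real m * snd x - 1)))
      \<longlonglongrightarrow> (LINT x:Omega R T|lborel. h x * \<zeta> x)"
proof -
  have Hc: "continuous_on UNIV (H 0)" and H0: "\<And>x. x \<le> 0 \<Longrightarrow> H 0 x = 0" and H1: "\<And>x. 1 \<le> x \<Longrightarrow> H 0 x = 1"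
    and Hb: "\<And>x. 0 \<le> H 0 x \<and> H 0 x \<le> 1"
    using H smooth_line_continuous unfolding smooth_step_def by auto
  obtain B where B: "0 < B" "\<And>x. x \<in> K \<Longrightarrow> \<bar>\<zeta> x\<bar> \<le> B"
    using continuous_bounded_on_compact[OF \<zeta>(1)] by blast
  define s where "s m x = indicator (Omega R T) x *\<^sub>R (h x * (\<zeta> x * H 0 (real m * snd x - 1)))" for m x
  define f where "f x = indicator (Omega R T) x *\<^sub>R (h x * \<zeta> x)" for x
  have s_meas: "s m \<in> borel_measurable lborel" for m
  proof (cases "m = 0")
    case True
    then show ?thesis by (simp add: s_def[abs_def] H0)
  next
    case False
    define Km where "Km = K \<inter> {x. 1 / real m \<le> snd x}"
    have "set_integrable lborel Km h"
      using h compact_above[of "1 / real m"] False unfolding L1_loc_def Km_def by simp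
    then have 1: "(\<lambda>x. indicator Km x *\<^sub>R h x) \<in> borel_measurable lborel"
      unfolding set_integrable_def by (rule borel_measurable_integrable)
    have "continuous_on (Omega R T) (\<lambda>x. \<zeta> x * H 0 (real m * snd x - 1))"
      by (intro continuous_intros continuous_on_subset[OF \<zeta>(1) Omega_subset_Theta]
          continuous_on_compose2[OF Hc]) auto
    then have "(\<lambda>x. indicator (Omega R T) x *\<^sub>R (\<zeta> x * H 0 (real m * snd x - 1))) \<in> borel_measurable borel"
      by (intro borel_measurable_continuous_on_indicator borel_open open_Omega)
    with 1 have "(\<lambda>x. (indicator Km x *\<^sub>R h x) * (indicator (Omega R T) x *\<^sub>R (\<zeta> x * H 0 (real m * snd x - 1))))
        \<in> borel_measurable lborel"
      by (intro borel_measurable_times) simp_all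
    moreover have "s m x = (indicator Km x *\<^sub>R h x) * (indicator (Omega R T) x *\<^sub>R (\<zeta> x * H 0 (real m * snd x - 1)))" for x
    proof -
      have "H 0 (real m * snd x - 1) = 0" if "snd x < 1 / real m"
        using that False by (intro H0) (simp add: field_simps)
      then show ?thesis
        using \<zeta>(2)[of x] unfolding s_def Km_def by (cases "x \<in> K"; cases "1 / real m \<le> snd x") (auto simp: indicator_def)
    qed
    ultimately show ?thesis by (simp cong: measurable_cong)
  qed
  have lim: "(\<lambda>m. s m x) \<longlonglongrightarrow> f x" for x
  proof (cases "x \<in> Omega R T")
    case True
    obtain N :: nat where N: "2 / snd x < real N" using reals_Archimedean2 by blast
    have "s m x = f x" if "N \<le> m" for m
    proof -
      have "2 / snd x < real m" using N that by linarith
      then have "1 \<le> real m * snd x - 1" using True by (simp add: Omega_iff field_simps)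
      then show ?thesis by (simp add: s_def f_def H1)
    qed
    then show ?thesis by (intro tendsto_eventually eventually_sequentiallyI[of N])
  qed (simp add: s_def f_def)
  have f_meas: "f \<in> borel_measurable lborel"
    by (rule borel_measurable_LIMSEQ_real[OF lim s_meas])
  have w_int: "integrable lborel (\<lambda>x. B * (indicator K x *\<^sub>R w x))"
    using w unfolding set_integrable_def by simp
  have bound: "norm (s m x) \<le> B * (indicator K x *\<^sub>R w x)" for m x
  proof (cases "x \<in> K")
    case True
    have "\<bar>h x\<bar> * (\<bar>\<zeta> x\<bar> * \<bar>H 0 (real m * snd x - 1)\<bar>) \<le> w x * (B * 1)"
      using hw[OF True] B(1) B(2)[OF True] Hb[of "real m * snd x - 1"] abs_ge_zero[of "h x"]
      by (intro mult_mono mult_nonneg_nonneg) linarith+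
    moreover have "0 \<le> w x" using hw[OF True] abs_ge_zero[of "h x"] by linarith
    ultimately show ?thesis using True B(1) by (auto simp: s_def indicator_def abs_mult mult.commute)
  qed (use \<zeta>(2)[of x] in \<open>auto simp: s_def indicator_def\<close>)
  show "set_integrable lborel (Omega R T) (\<lambda>x. h x * \<zeta> x)"
    using integrable_dominated_convergence[OF f_meas s_meas w_int AE_I2[OF lim] AE_I2[OF bound]]
    unfolding set_integrable_def f_def .
  show "(\<lambda>m. LINT x:Omega R T|lborel. h x * (\<zeta> x * H 0 (real m * snd x - 1)))
      \<longlonglongrightarrow> (LINT x:Omega R T|lborel. h x * \<zeta> x)"
    using integral_dominated_convergence[OF f_meas s_meas w_int AE_I2[OF lim] AE_I2[OF bound]]
    unfolding set_lebesgue_integral_def f_def s_def .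
qed

text \<open>The derivative of the cutoff is of size \<open>m\<close> on a strip of width \<open>1/m\<close>, so its integral stays bounded. It
  is multiplied by \<open>u\<close>, which tends to \<open>0\<close> uniformly on \<open>K\<close> as \<open>t \<rightarrow> 0\<close> because of the initial
  condition and compactness.\<close>

lemma cutoff_boundary_limit:
  fixes u \<zeta> :: "real \<times> real \<Rightarrow> real"
  assumes H: "smooth_step H"
    and u: "continuous_on (Theta R T) u" "\<And>r. R < r \<Longrightarrow> u (r, 0) = 0"
    and \<zeta>: "continuous_on (Theta R T) \<zeta>" "\<And>x. x \<in> Omega R T - K \<Longrightarrow> \<zeta> x = 0"
  shows "(\<lambda>m. LINT x:Omega R T|lborel. u x * (\<zeta> x * (real m * H (Suc 0) (real m * snd x - 1)))) \<longlonglongrightarrow> 0"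
proof -
  have Hc: "continuous_on UNIV (H (Suc 0))" and H0: "\<And>x. x \<le> 0 \<or> 1 \<le> x \<Longrightarrow> H (Suc 0) x = 0"
    using H smooth_line_continuous unfolding smooth_step_def by auto
  obtain B where B: "0 < B" "\<And>x. x \<in> K \<Longrightarrow> \<bar>\<zeta> x\<bar> \<le> B"
    using continuous_bounded_on_compact[OF \<zeta>(1)] by blast
  have "bounded (H (Suc 0) ` {0..1})"
    by (meson Hc compact_Icc compact_continuous_image compact_imp_bounded continuous_on_subset subset_UNIV)
  then obtain M where M: "0 < M" "\<And>x. x \<in> {0..1} \<Longrightarrow> \<bar>H (Suc 0) x\<bar> \<le> M"
    by (auto simp: bounded_pos)
  then have M': "\<bar>H (Suc 0) x\<bar> \<le> M" for x
    using H0[of x] by (cases "x \<in> {0..1}") auto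
  have "bounded (fst ` K)" using bounded_fst K(1) compact_imp_bounded by blast
  then obtain L where L: "0 < L" "\<And>x. x \<in> K \<Longrightarrow> \<bar>fst x\<bar> \<le> L" by (auto simp: bounded_pos)
  show ?thesis
  proof (rule LIMSEQ_I)
    fix e :: real assume e: "0 < e"
    define e' where "e' = e / (2 * (B * M * (2 * L)))"
    have e': "0 < e'" using e B(1) M(1) L(1) by (simp add: e'_def)
    \<comment> \<open>The points of \<open>K\<close> at which \<open>u\<close> is not small form a compact set off the initial line,
      hence they have a positive distance from it.\<close>
    define Z where "Z = K \<inter> {x. e' \<le> \<bar>u x\<bar>}"
    have uK: "continuous_on K (\<lambda>x. \<bar>u x\<bar>)"
      by (intro continuous_on_rabs continuous_on_subset[OF u(1) K(2)])
    have "Z = K \<inter> (\<lambda>x. \<bar>u x\<bar>) -` {e'..}" by (auto simp: Z_def)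
    then have "closed Z"
      using continuous_closed_preimage[OF uK compact_imp_closed[OF K(1)] closed_atLeast[of e']] by simp
    moreover have "K \<inter> Z = Z" by (auto simp: Z_def)
    ultimately have Zc: "compact Z" using compact_Int_closed[OF K(1), of Z] by simp
    have Zpos: "0 < snd x" if "x \<in> Z" for x
    proof -
      have "x \<in> Theta R T" using that K(2) by (auto simp: Z_def)
      moreover have "snd x \<noteq> 0"
      proof
        assume "snd x = 0"
        then have "u x = 0" using u(2)[of "fst x"] \<open>x \<in> Theta R T\<close> by (cases x) (auto simp: Theta_iff)
        then show False using that e' by (simp add: Z_def)
      qed
      ultimately show ?thesis by (auto simp: Theta_iff)
    qed
    obtain d where d: "0 < d" "\<And>x. x \<in> Z \<Longrightarrow> d \<le> snd x"
    proof (cases "Z = {}")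
      case True
      then show ?thesis using that[of 1] by simp
    next
      case False
      have "\<exists>x\<in>Z. \<forall>y\<in>Z. snd x \<le> snd y"
        by (intro continuous_attains_inf Zc False continuous_intros)
      then show ?thesis using that Zpos by blast
    qed
    have small: "\<bar>u x\<bar> \<le> e'" if "x \<in> K" "snd x < d" for x
    proof (rule ccontr)
      assume "\<not> \<bar>u x\<bar> \<le> e'"
      then have "x \<in> Z" using that by (simp add: Z_def)
      then show False using d(2)[of x] that(2) by simp
    qed
    obtain N :: nat where N: "2 / d < real N" using reals_Archimedean2 by blast
    have "norm ((LINT x:Omega R T|lborel. u x * (\<zeta> x * (real m * H (Suc 0) (real m * snd x - 1)))) - 0) < e"
      if "N \<le> m" for m
    proof -
      have "2 / d < real m" "0 < 2 / d" using N that d(1) by auto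
      then have "0 < real m" by linarith
      with \<open>2 / d < real m\<close> have m: "0 < real m" "2 / real m < d" using d(1) by (simp_all add: field_simps)
      define S where "S = cbox (- L, 1 / real m) (L, 2 / real m)"
      have "S = {-L..L} \<times> {1 / real m..2 / real m}" unfolding S_def cbox_Pair_eq by simp
      then have Smeas: "measure lborel S = 2 * L * (1 / real m)"
        using L(1) m(1) unfolding S_def by (subst measure_lborel_cbox_eq) (auto simp: Basis_prod_def field_simps)
      have pt: "\<bar>indicator (Omega R T) x *\<^sub>R (u x * (\<zeta> x * (real m * H (Suc 0) (real m * snd x - 1))))\<bar>
          \<le> (e' * B * real m * M) * indicator S x" for x
      proof (cases "x \<in> Omega R T \<and> x \<in> K \<and> 1 / real m < snd x \<and> snd x < 2 / real m")
        case True
        have "x \<in> S"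
          using True L(2)[of x] unfolding \<open>S = {-L..L} \<times> {1 / real m..2 / real m}\<close> mem_Times_iff by (simp add: abs_le_iff)
        moreover have "\<bar>u x\<bar> * (\<bar>\<zeta> x\<bar> * (real m * \<bar>H (Suc 0) (real m * snd x - 1)\<bar>)) \<le> e' * (B * (real m * M))"
          using small[of x] True m B(1) B(2)[of x] M' e' by (intro mult_mono) auto
        ultimately show ?thesis using True by (simp add: abs_mult mult.assoc)
      next
        case False
        have "\<zeta> x = 0 \<or> H (Suc 0) (real m * snd x - 1) = 0 \<or> x \<notin> Omega R T"
        proof (cases "x \<in> Omega R T - K")
          case False2: False
          have "H (Suc 0) (real m * snd x - 1) = 0" if "x \<in> Omega R T"
            using that False False2 m(1) by (intro H0) (auto simp: field_simps)
          then show ?thesis by blast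
        qed (use \<zeta>(2) in blast)
        then show ?thesis using e' B(1) M(1) m(1) by (auto simp: indicator_def)
      qed
      have "\<bar>LINT x:Omega R T|lborel. u x * (\<zeta> x * (real m * H (Suc 0) (real m * snd x - 1)))\<bar>
          \<le> (e' * B * real m * M) * measure lborel S"
        unfolding set_lebesgue_integral_def
        by (rule integral_abs_le_measure[OF pt]) (use e' B(1) M(1) m(1) in \<open>simp_all add: S_def emeasure_lborel_cbox_finite[unfolded infinity_ennreal_def]\<close>)
      also have "\<dots> = e / 2"
        unfolding Smeas e'_def using B(1) M(1) L(1) m(1) by (simp add: field_simps)
      also have "\<dots> < e" using e by simp
      finally show ?thesis by simp
    qed
    then show "\<exists>no. \<forall>m\<ge>no. norm ((LINT x:Omega R T|lborel.
        u x * (\<zeta> x * (real m * H (Suc 0) (real m * snd x - 1)))) - 0) < e"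
      by blast
  qed
qed

text \<open>On a compact set \<open>r\<close> is bounded away from \<open>0\<close>, so the weight can be removed, and \<open>s \<le> 1 + s\<^sup>2\<close> makes
  an integrable bound from a square integrable one.\<close>

lemma finite_energy_dominator:
  assumes "0 < R"
    and "L2_loc (Theta R T) (\<lambda>(r, t). r powr \<alpha> * (\<bar>u (r, t)\<bar> + \<bar>ur (r, t)\<bar> + \<bar>ut (r, t)\<bar>))"
  obtains w :: "real \<times> real \<Rightarrow> real" where "set_integrable lborel K w"
    and "\<And>x. x \<in> K \<Longrightarrow> \<bar>u x\<bar> \<le> w x" and "\<And>x. x \<in> K \<Longrightarrow> \<bar>ur x\<bar> \<le> w x" and "\<And>x. x \<in> K \<Longrightarrow> \<bar>ut x\<bar> \<le> w x"
proof -
  define s where "s x = fst x powr \<alpha> * (\<bar>u x\<bar> + \<bar>ur x\<bar> + \<bar>ut x\<bar>)" for x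
  have s: "set_integrable lborel K (\<lambda>x. (s x)\<^sup>2)"
    using assms(2) K unfolding L2_loc_def s_def by (simp add: case_prod_beta')
  have pos: "0 < fst x" if "x \<in> Theta R T" for x using that assms(1) by (auto simp: Theta_iff)
  have "continuous_on (Theta R T) (\<lambda>x. fst x powr (- \<alpha>))"
    using pos by (intro continuous_intros) force
  then obtain C where C: "0 < C" "\<And>x. x \<in> K \<Longrightarrow> \<bar>fst x powr (- \<alpha>)\<bar> \<le> C"
    using continuous_bounded_on_compact by blast
  have "set_integrable lborel K (\<lambda>x. C * (1 + (s x)\<^sup>2))"
    using s K(1) by (intro set_integrable_mult_right set_integral_add) 
      (use borel_integrable_compact[OF K(1), of "\<lambda>_. 1::real"] in \<open>auto simp: set_integrable_def\<close>)
  have bd: "\<bar>u x\<bar> + \<bar>ur x\<bar> + \<bar>ut x\<bar> \<le> C * (1 + (s x)\<^sup>2)" if "x \<in> K" for x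
  proof -
    have p: "0 < fst x" using that K(2) pos by blast
    have s0: "0 \<le> s x" unfolding s_def by (intro mult_nonneg_nonneg) auto
    have "\<bar>u x\<bar> + \<bar>ur x\<bar> + \<bar>ut x\<bar> = fst x powr (- \<alpha>) * s x"
      using p by (simp add: s_def powr_minus)
    also have "\<dots> \<le> C * s x" using C(2)[OF that] s0 by (intro mult_right_mono) auto
    also have "\<dots> \<le> C * (1 + (s x)\<^sup>2)"
      using C(1) s0 zero_le_power2[of "s x - 1"] by (intro mult_left_mono) (auto simp: power2_eq_square algebra_simps)
    finally show ?thesis .
  qed
  show ?thesis
  proof (rule that)
    show "set_integrable lborel K (\<lambda>x. C * (1 + (s x)\<^sup>2))" by fact
    show "\<bar>u x\<bar> \<le> C * (1 + (s x)\<^sup>2)" "\<bar>ur x\<bar> \<le> C * (1 + (s x)\<^sup>2)" "\<bar>ut x\<bar> \<le> C * (1 + (s x)\<^sup>2)"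
      if "x \<in> K" for x using bd[OF that] by linarith+
  qed
qed

end

section \<open>The equation for the weighted solution\<close>

lemma test_functions_cutoff:
  assumes H: "smooth_step H" and f: "smooth_plane f" and S: "compact S" "\<And>x. x \<notin> S \<Longrightarrow> f x = 0"
    and ST: "S \<subseteq> Theta R T \<union> {(r, t). t < 0}"
  shows "(\<lambda>x. f x * H 0 (real m * snd x - 1)) \<in> test_functions (Omega R T)"
proof (cases "m = 0")
  case True
  have "H 0 (- 1) = 0" using H by (simp add: smooth_step_def)
  moreover have "smooth_plane (\<lambda>x. 0)"
    using smooth_plane_cmult[OF f, of 0] by simp
  ultimately show ?thesis using True by (simp add: test_functions_def)
next
  case False
  define S' where "S' = S \<inter> {x. 1 / real m \<le> snd x}"
  have "closed {x::real\<times>real. 1 / real m \<le> snd x}" by (intro closed_Collect_le continuous_intros)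
  then have S'c: "compact S'" unfolding S'_def using S(1) by (intro compact_Int_closed)
  have "S' \<subseteq> Omega R T"
  proof
    fix x assume x: "x \<in> S'"
    have "0 < 1 / real m" using False by simp
    also have "\<dots> \<le> snd x" using x by (simp add: S'_def)
    finally have pos: "0 < snd x" .
    with x ST have "x \<in> Theta R T" by (auto simp: S'_def)
    with pos show "x \<in> Omega R T" by (simp add: Omega_iff Theta_iff)
  qed
  have "f x * H 0 (real m * snd x - 1) = 0" if "x \<notin> S'" for x
  proof (cases "x \<in> S")
    case True
    then have "real m * snd x - 1 \<le> 0" using that False by (auto simp: S'_def field_simps)
    then show ?thesis using H by (simp add: smooth_step_def)
  qed (simp add: S(2))
  then have "{x. f x * H 0 (real m * snd x - 1) \<noteq> 0} \<subseteq> S'" by blast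
  then have sub: "closure {x. f x * H 0 (real m * snd x - 1) \<noteq> 0} \<subseteq> S'"
    by (rule closure_minimal) (rule compact_imp_closed[OF S'c])
  have "smooth_line H" using H by (simp add: smooth_step_def)
  from smooth_plane_affine[OF this, of "-1" 0 "real m"]
  have "smooth_plane (\<lambda>x. H 0 (real m * snd x - 1))" by simp
  then have "smooth_plane (\<lambda>x. f x * H 0 (real m * snd x - 1))" by (rule smooth_plane_mult[OF f])
  moreover have "compact (closure {x. f x * H 0 (real m * snd x - 1) \<noteq> 0})"
    using compact_Int_closed[OF S'c, of "closure {x. f x * H 0 (real m * snd x - 1) \<noteq> 0}"] sub
    by (simp add: inf.absorb2)
  ultimately show ?thesis
    using sub \<open>S' \<subseteq> Omega R T\<close> unfolding test_functions_def by blast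
qed

text \<open>The weak equation with test function \<open>r\<^sup>\<alpha> \<phi>\<close>, after a second integration by parts. With
  \<open>2\<alpha> = n - 1\<close> the first-order terms in \<open>\<phi>\<close> cancel, and the term \<open>\<alpha>(\<alpha> - 1) r\<^sup>-\<^sup>2\<close> is left. Since the weak
  derivatives of \<open>u\<close> may be tested only in the interior, the integration by parts is carried out with
  a cutoff in \<open>t\<close>.\<close>

lemma weak_form_powr_weight:
  fixes \<phi> :: "real \<times> real \<Rightarrow> real"
  assumes sol: "is_solution n R g \<psi> T u" and R: "0 < R" and H: "smooth_step H"
    and \<phi>: "smooth_plane \<phi>" "compact S" "\<And>x. x \<notin> S \<Longrightarrow> \<phi> x = 0"
    and S: "S \<subseteq> Theta R T \<union> {(r, t). t < 0}" "S \<subseteq> {x. 0 < fst x}"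
    and \<alpha>: "\<alpha> = (real n - 1) / 2"
  shows "(LINT x:Omega R T|lborel. u x * (fst x powr \<alpha> * (pd_t (pd_t \<phi>) x - pd_r (pd_r \<phi>) x)
            + \<alpha> * (\<alpha> - 1) * fst x powr (\<alpha> - 2) * \<phi> x))
       = (LINT x:Omega R T|lborel. g (fst x, u x) * (fst x powr \<alpha> * \<phi> x))
         + (LINT r:{R<..}|lborel. \<psi> r * (r powr \<alpha> * \<phi> (r, 0)))"
proof -
  obtain ur ut where wr: "weak_pd_r (Omega R T) u ur" and wt: "weak_pd_t (Omega R T) u ut"
    and L2: "L2_loc (Theta R T)
          (\<lambda>(r, t). r powr ((real n - 1) / 2) * (\<bar>u (r, t)\<bar> + \<bar>ur (r, t)\<bar> + \<bar>ut (r, t)\<bar>))"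
    and weak: "\<And>\<phi>. \<phi> \<in> test_functions (Theta R T \<union> {(r, t). t < 0}) \<Longrightarrow>
           (LINT (r, t):Omega R T|lborel.
              - ut (r, t) * pd_t \<phi> (r, t) + ur (r, t) * pd_r \<phi> (r, t)
              - (real n - 1) / r * ur (r, t) * \<phi> (r, t)) =
           (LINT (r, t):Omega R T|lborel. g (r, u (r, t)) * \<phi> (r, t)) +
           (LINT r:{R<..}|lborel. \<psi> r * \<phi> (r, 0))"
    and uc: "continuous_on (Theta R T) u" and u0: "\<And>r. R < r \<Longrightarrow> u (r, 0) = 0"
    using sol unfolding is_solution_def interior_Theta by blast
  obtain D where D0: "D 0 0 = \<phi>" and D: "smooth_family UNIV D"
    using \<phi>(1) unfolding smooth_plane_iff by blast
  note Dr = smooth_familyD(2)[OF D UNIV_I] and Dt = smooth_familyD(3)[OF D UNIV_I]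
  have Dc: "continuous_on A (D i j)" for A i j
    using smooth_familyD(1)[OF D] continuous_on_subset subset_UNIV by blast
  have Dz: "D i j x = 0" if "x \<notin> S" for i j x
    using smooth_family_zero[of "- S" D i j] smooth_family_subset[OF D] \<phi>(2,3) D0 that
    by (auto simp: open_Compl compact_imp_closed)
  have Dpl: "smooth_plane (D i j)" for i j
    unfolding smooth_plane_iff
    by (rule exI[of _ "\<lambda>k l. D (k + i) (l + j)"]) (use D in \<open>simp add: smooth_family_def\<close>)
  have pdr: "pd_r (D i j) = D (Suc i) j" and pdt: "pd_t (D i j) = D i (Suc j)" for i j
    using Dr Dt by (auto simp: pd_r_def pd_t_def fun_eq_iff intro!: DERIV_imp_deriv)
  have Wpl: "smooth_plane (\<lambda>x. fst x powr a * D i j x)" for a i j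
  proof (rule smooth_plane_powr_mult[OF Dpl])
    have "{x. D i j x \<noteq> 0} \<subseteq> S" using Dz by blast
    then have "closure {x. D i j x \<noteq> 0} \<subseteq> S"
      by (rule closure_minimal) (rule compact_imp_closed[OF \<phi>(2)])
    then show "closure {x. D i j x \<noteq> 0} \<subseteq> {x. 0 < fst x}" using S(2) by blast
  qed
  have pos: "0 < fst x" if "x \<in> Theta R T" for x using that R by (auto simp: Theta_iff)
  have powr_cont: "continuous_on (Theta R T) (\<lambda>x. fst x powr a)" for a
    by (intro continuous_on_powr continuous_intros) (use pos in fastforce)
  have posO: "0 < fst x" if "x \<in> Omega R T" for x
    using that pos Omega_subset_Theta by blast
  define K where "K = S \<inter> {x. 0 \<le> snd x}"
  have "closed {x::real\<times>real. 0 \<le> snd x}" by (intro closed_Collect_le continuous_intros)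
  then have Kc: "compact K" unfolding K_def using \<phi>(2) by (intro compact_Int_closed)
  have KT: "K \<subseteq> Theta R T" using S(1) by (auto simp: K_def)
  obtain w where w: "set_integrable lborel K w" "\<And>x. x \<in> K \<Longrightarrow> \<bar>u x\<bar> \<le> w x"
    "\<And>x. x \<in> K \<Longrightarrow> \<bar>ur x\<bar> \<le> w x" "\<And>x. x \<in> K \<Longrightarrow> \<bar>ut x\<bar> \<le> w x"
    using finite_energy_dominator[OF Kc KT R L2] by blast
  have L1: "L1_loc (Omega R T) u" "L1_loc (Omega R T) ur" "L1_loc (Omega R T) ut"
    using wr wt by (simp_all add: weak_pd_r_def weak_pd_t_def)
  have Hl: "(H k has_real_derivative H (Suc k) x) (at x)" for k x
    using H by (simp add: smooth_step_def smooth_line_def)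
  have Hc: "continuous_on UNIV (H k)" for k
    using H smooth_line_continuous by (simp add: smooth_step_def)
  \<comment> \<open>Apart from the cutoff, \<open>pt\<close> and \<open>pr\<close> are the functions that multiply \<open>-u\<^sub>t\<close> and \<open>u\<^sub>r\<close> in the weak
    equation, and \<open>ptt\<close> and \<open>prr\<close> are their derivatives in \<open>t\<close> and in \<open>r\<close>.\<close>
  define pt ptt prr pr where
    "pt x = fst x powr \<alpha> * D 0 (Suc 0) x"
    and "ptt x = fst x powr \<alpha> * D 0 (Suc (Suc 0)) x"
    and "prr x = fst x powr \<alpha> * D (Suc (Suc 0)) 0 x - \<alpha> * (\<alpha> - 1) * (fst x powr (\<alpha> - 2) * D 0 0 x)"
    and "pr x = fst x powr \<alpha> * D (Suc 0) 0 x - \<alpha> * (fst x powr (\<alpha> - 1) * D 0 0 x)" for x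
  note p_defs = pt_def ptt_def prr_def pr_def
  have pc: "continuous_on (Theta R T) pt" "continuous_on (Theta R T) ptt"
    "continuous_on (Theta R T) prr" "continuous_on (Theta R T) pr"
    unfolding p_defs by (intro continuous_intros powr_cont Dc)+
  have pz: "pt x = 0" "ptt x = 0" "prr x = 0" "pr x = 0" if "x \<in> Omega R T - K" for x
  proof -
    have "x \<notin> S" using that by (auto simp: K_def Omega_iff)
    then show "pt x = 0" "ptt x = 0" "prr x = 0" "pr x = 0" by (simp_all add: p_defs Dz)
  qed
  have p_test: "(\<lambda>x. pt x * H 0 (real m * snd x - 1)) \<in> test_functions (Omega R T)"
    "(\<lambda>x. pr x * H 0 (real m * snd x - 1)) \<in> test_functions (Omega R T)" for m
  proof -
    have "smooth_plane pt" "smooth_plane pr"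
      unfolding p_defs by (intro Wpl smooth_plane_diff smooth_plane_cmult)+
    moreover have "pt x = 0" "pr x = 0" if "x \<notin> S" for x by (simp_all add: p_defs Dz[OF that])
    ultimately show "(\<lambda>x. pt x * H 0 (real m * snd x - 1)) \<in> test_functions (Omega R T)"
      "(\<lambda>x. pr x * H 0 (real m * snd x - 1)) \<in> test_functions (Omega R T)"
      using test_functions_cutoff[OF H _ \<phi>(2) _ S(1)] by auto
  qed
  have dt: "pd_t (\<lambda>x. pt x * H 0 (real m * snd x - 1)) x
      = ptt x * H 0 (real m * snd x - 1) + pt x * (real m * H (Suc 0) (real m * snd x - 1))" for m x
  proof (cases x)
    case (Pair r t)
    have 1: "((\<lambda>s. r powr \<alpha> * D 0 (Suc 0) (r, s)) has_real_derivative r powr \<alpha> * D 0 (Suc (Suc 0)) (r, t)) (at t)"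
      by (rule DERIV_cmult[OF Dt])
    have 2: "((\<lambda>s. H 0 (real m * s - 1)) has_real_derivative H (Suc 0) (real m * t - 1) * real m) (at t)"
      by (rule DERIV_chain2[OF Hl]) (auto intro!: derivative_eq_intros)
    show ?thesis
      using DERIV_imp_deriv[OF DERIV_mult[OF 1 2]] unfolding Pair pd_t_def p_defs by (simp add: algebra_simps)
  qed
  have dr: "pd_r (\<lambda>x. pr x * H 0 (real m * snd x - 1)) x = prr x * H 0 (real m * snd x - 1)"
    if "x \<in> Omega R T" for m x
  proof (cases x)
    case (Pair r t)
    have r: "0 < r" using posO[OF that] Pair by simp
    have pw: "((\<lambda>s. s powr a) has_real_derivative a * r powr (a - 1)) (at r)" for a
      using r by (auto intro!: derivative_eq_intros)
    have "((\<lambda>s. s powr \<alpha> * D (Suc 0) 0 (s, t) - \<alpha> * (s powr (\<alpha> - 1) * D 0 0 (s, t))) has_real_derivative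
       (\<alpha> * r powr (\<alpha> - 1) * D (Suc 0) 0 (r, t) + D (Suc (Suc 0)) 0 (r, t) * r powr \<alpha>)
       - \<alpha> * ((\<alpha> - 1) * r powr (\<alpha> - 1 - 1) * D 0 0 (r, t) + D (Suc 0) 0 (r, t) * r powr (\<alpha> - 1))) (at r)"
      by (intro DERIV_diff DERIV_cmult DERIV_mult pw Dr)
    from DERIV_imp_deriv[OF DERIV_mult[OF this DERIV_const[of "H 0 (real m * t - 1)"]]]
    show ?thesis unfolding Pair pd_r_def p_defs by (simp add: algebra_simps)
  qed
  have I1: "(LINT x:Omega R T|lborel. u x * ptt x) = - (LINT x:Omega R T|lborel. ut x * pt x)"
  proof -
    have "(LINT x:Omega R T|lborel. u x * (ptt x * H 0 (real m * snd x - 1)))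
        + (LINT x:Omega R T|lborel. u x * (pt x * (real m * H (Suc 0) (real m * snd x - 1))))
        = - (LINT x:Omega R T|lborel. ut x * (pt x * H 0 (real m * snd x - 1)))" for m
    proof -
      have c1: "continuous_on (Theta R T) (\<lambda>x. ptt x * H 0 (real m * snd x - 1))"
        "continuous_on (Theta R T) (\<lambda>x. pt x * (real m * H (Suc 0) (real m * snd x - 1)))"
        by (intro continuous_intros pc continuous_on_compose2[OF Hc] subset_UNIV)+
      have i1: "set_integrable lborel (Omega R T) (\<lambda>x. u x * (ptt x * H 0 (real m * snd x - 1)))"
        by (rule cutoff_integral_limit(1)[OF Kc KT H L1(1) w(1,2) c1(1)]) (simp_all add: pz)
      have i2: "set_integrable lborel (Omega R T) (\<lambda>x. u x * (pt x * (real m * H (Suc 0) (real m * snd x - 1))))"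
        by (rule cutoff_integral_limit(1)[OF Kc KT H L1(1) w(1,2) c1(2)]) (simp_all add: pz)
      have "(LINT x:Omega R T|lborel. u x * pd_t (\<lambda>x. pt x * H 0 (real m * snd x - 1)) x)
        = - (LINT x:Omega R T|lborel. ut x * (pt x * H 0 (real m * snd x - 1)))"
        using wt p_test(1)[of m] unfolding weak_pd_t_def by blast
      then show ?thesis unfolding dt distrib_left set_integral_add(2)[OF i1 i2] .
    qed
    moreover have "(\<lambda>m. (LINT x:Omega R T|lborel. u x * (ptt x * H 0 (real m * snd x - 1)))
        + (LINT x:Omega R T|lborel. u x * (pt x * (real m * H (Suc 0) (real m * snd x - 1)))))
        \<longlonglongrightarrow> (LINT x:Omega R T|lborel. u x * ptt x) + 0"
      by (intro tendsto_add cutoff_integral_limit(2)[OF Kc KT H L1(1) w(1,2)]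
          cutoff_boundary_limit[OF Kc KT H uc u0] pc pz)
    moreover have "(\<lambda>m. - (LINT x:Omega R T|lborel. ut x * (pt x * H 0 (real m * snd x - 1))))
        \<longlonglongrightarrow> - (LINT x:Omega R T|lborel. ut x * pt x)"
      by (intro tendsto_minus cutoff_integral_limit(2)[OF Kc KT H L1(3) w(1,4)] pc pz)
    ultimately show ?thesis using LIMSEQ_unique by auto
  qed
  have I2: "(LINT x:Omega R T|lborel. u x * prr x) = - (LINT x:Omega R T|lborel. ur x * pr x)"
  proof -
    have "(LINT x:Omega R T|lborel. u x * (prr x * H 0 (real m * snd x - 1)))
        = - (LINT x:Omega R T|lborel. ur x * (pr x * H 0 (real m * snd x - 1)))" for m
    proof -
      have "(LINT x:Omega R T|lborel. u x * pd_r (\<lambda>x. pr x * H 0 (real m * snd x - 1)) x)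
        = - (LINT x:Omega R T|lborel. ur x * (pr x * H 0 (real m * snd x - 1)))"
        using wr p_test(2)[of m] unfolding weak_pd_r_def by blast
      moreover have "(LINT x:Omega R T|lborel. u x * pd_r (\<lambda>x. pr x * H 0 (real m * snd x - 1)) x)
        = (LINT x:Omega R T|lborel. u x * (prr x * H 0 (real m * snd x - 1)))"
        by (intro set_lebesgue_integral_cong) (use open_Omega in \<open>auto simp: dr\<close>)
      ultimately show ?thesis by simp
    qed
    moreover have "(\<lambda>m. LINT x:Omega R T|lborel. u x * (prr x * H 0 (real m * snd x - 1)))
        \<longlonglongrightarrow> (LINT x:Omega R T|lborel. u x * prr x)"
      by (intro cutoff_integral_limit(2)[OF Kc KT H L1(1) w(1,2)] pc pz)
    moreover have "(\<lambda>m. - (LINT x:Omega R T|lborel. ur x * (pr x * H 0 (real m * snd x - 1))))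
        \<longlonglongrightarrow> - (LINT x:Omega R T|lborel. ur x * pr x)"
      by (intro tendsto_minus cutoff_integral_limit(2)[OF Kc KT H L1(2) w(1,3)] pc pz)
    ultimately show ?thesis using LIMSEQ_unique by auto
  qed
  note int = cutoff_integral_limit(1)[OF Kc KT H]
  have i: "set_integrable lborel (Omega R T) (\<lambda>x. u x * ptt x)" "set_integrable lborel (Omega R T) (\<lambda>x. u x * prr x)"
    "set_integrable lborel (Omega R T) (\<lambda>x. ur x * pr x)" "set_integrable lborel (Omega R T) (\<lambda>x. ut x * pt x)"
    by (intro int[OF L1(1) w(1,2)] int[OF L1(2) w(1,3)] int[OF L1(3) w(1,4)] pc pz; assumption)+
  define f where "f x = fst x powr \<alpha> * D 0 0 x" for x
  have ft: "f \<in> test_functions (Theta R T \<union> {(r, t). t < 0})"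
  proof -
    have "{x. f x \<noteq> 0} \<subseteq> S" using Dz by (auto simp: f_def)
    then have sub: "closure {x. f x \<noteq> 0} \<subseteq> S"
      by (rule closure_minimal) (rule compact_imp_closed[OF \<phi>(2)])
    moreover have "compact (closure {x. f x \<noteq> 0})"
      using compact_Int_closed[OF \<phi>(2), of "closure {x. f x \<noteq> 0}"] sub by (simp add: inf.absorb2)
    moreover have "smooth_plane f" unfolding f_def by (rule Wpl)
    ultimately show ?thesis using S(1) unfolding test_functions_def by blast
  qed
  have integrand: "- ut (r, t) * pd_t f (r, t) + ur (r, t) * pd_r f (r, t) - (real n - 1) / r * ur (r, t) * f (r, t)
      = ur (r, t) * pr (r, t) - ut (r, t) * pt (r, t)" if "(r, t) \<in> Omega R T" for r t
  proof -
    have r: "0 < r" using posO[OF that] by simp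
    have "pd_t f (r, t) = pt (r, t)"
      using DERIV_imp_deriv[OF DERIV_cmult[OF Dt[where i=0 and j=0 and r=r and t=t], of "r powr \<alpha>"]] by (simp add: pd_t_def f_def pt_def)
    moreover have "((\<lambda>s. s powr \<alpha>) has_real_derivative \<alpha> * r powr (\<alpha> - 1)) (at r)"
      using r by (auto intro!: derivative_eq_intros)
    from DERIV_imp_deriv[OF DERIV_mult[OF this Dr[where i=0 and j=0 and r=r and t=t]]]
    have "pd_r f (r, t) = \<alpha> * r powr (\<alpha> - 1) * D 0 0 (r, t) + D (Suc 0) 0 (r, t) * r powr \<alpha>"
      by (simp add: pd_r_def f_def)
    moreover have "(real n - 1) / r * f (r, t) = 2 * \<alpha> * (r powr (\<alpha> - 1) * D 0 0 (r, t))"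
    proof -
      have "real n - 1 = 2 * \<alpha>" using \<alpha> by simp
      then show ?thesis using r by (simp add: f_def powr_diff)
    qed
    then have "(real n - 1) / r * ur (r, t) * f (r, t) = ur (r, t) * (2 * \<alpha> * (r powr (\<alpha> - 1) * D 0 0 (r, t)))"
      by (metis mult.assoc mult.commute)
    ultimately show ?thesis by (simp add: pr_def algebra_simps)
  qed
  have "(LINT x:Omega R T|lborel. u x * (fst x powr \<alpha> * (pd_t (pd_t \<phi>) x - pd_r (pd_r \<phi>) x)
            + \<alpha> * (\<alpha> - 1) * fst x powr (\<alpha> - 2) * \<phi> x))
      = (LINT x:Omega R T|lborel. u x * ptt x - u x * prr x)"
    unfolding D0[symmetric] pdr pdt p_defs by (simp add: algebra_simps)
  also have "\<dots> = (LINT x:Omega R T|lborel. ur x * pr x) - (LINT x:Omega R T|lborel. ut x * pt x)"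
    using set_integral_diff(2)[OF i(1,2)] I1 I2 by simp
  also have "\<dots> = (LINT x:Omega R T|lborel. ur x * pr x - ut x * pt x)"
    using set_integral_diff(2)[OF i(3,4)] by simp
  also have "\<dots> = (LINT (r, t):Omega R T|lborel.
              - ut (r, t) * pd_t f (r, t) + ur (r, t) * pd_r f (r, t)
              - (real n - 1) / r * ur (r, t) * f (r, t))"
    by (rule set_lebesgue_integral_cong) (use open_Omega integrand in auto)
  also have "\<dots> = (LINT (r, t):Omega R T|lborel. g (r, u (r, t)) * f (r, t)) +
           (LINT r:{R<..}|lborel. \<psi> r * f (r, 0))"
    by (rule weak[OF ft])
  also have "\<dots> = (LINT x:Omega R T|lborel. g (fst x, u x) * (fst x powr \<alpha> * \<phi> x))
         + (LINT r:{R<..}|lborel. \<psi> r * (r powr \<alpha> * \<phi> (r, 0)))"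
    by (simp add: f_def D0 case_prod_beta')
  finally show ?thesis .
qed

section \<open>Positivity for an integral equation on characteristic triangles\<close>

text \<open>The backward characteristic triangle of \<open>P\<close>, without its boundary; \<open>fst x - snd x\<close> and
  \<open>fst x + snd x\<close> are the characteristic coordinates.\<close>

definition back_cone :: "real \<times> real \<Rightarrow> (real \<times> real) set" where
  "back_cone P = {x. 0 < snd x \<and> fst P - snd P < fst x - snd x \<and> fst x + snd x < fst P + snd P}"

definition closed_back_cone :: "real \<times> real \<Rightarrow> (real \<times> real) set" where
  "closed_back_cone P = {x. 0 \<le> snd x \<and> fst P - snd P \<le> fst x - snd x \<and> fst x + snd x \<le> fst P + snd P}"

lemma open_back_cone: "open (back_cone P)"
  unfolding back_cone_def by (intro open_Collect_conj open_Collect_less continuous_intros)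

lemma back_cone_mono: "Q \<in> closed_back_cone P \<Longrightarrow> back_cone Q \<subseteq> back_cone P"
  by (auto simp: back_cone_def closed_back_cone_def)

lemma back_cone_subset_closed_back_cone: "back_cone P \<subseteq> closed_back_cone P"
  by (auto simp: back_cone_def closed_back_cone_def)

lemma closed_back_cone_subset_cbox:
  "closed_back_cone P \<subseteq> cbox (fst P - snd P, 0) (fst P + snd P, snd P)"
  unfolding cbox_Pair_eq by (auto simp: closed_back_cone_def)

lemma compact_closed_back_cone: "compact (closed_back_cone P)"
proof -
  have "closed (closed_back_cone P)"
    unfolding closed_back_cone_def by (intro closed_Collect_conj closed_Collect_le continuous_intros)
  then show ?thesis
    using closed_back_cone_subset_cbox[of P] bounded_cbox bounded_subset compact_eq_bounded_closed by blast
qed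

lemma set_integrable_cone:
  fixes f :: "real \<times> real \<Rightarrow> real"
  assumes "continuous_on (closed_back_cone P) f" "Q \<in> closed_back_cone P"
  shows "set_integrable lborel (back_cone Q) f"
proof (rule set_integrable_subset)
  show "set_integrable lborel (closed_back_cone P) f"
    unfolding set_integrable_def by (rule borel_integrable_compact[OF compact_closed_back_cone assms(1)])
  show "back_cone Q \<in> sets lborel" using open_back_cone by simp
  show "back_cone Q \<subseteq> closed_back_cone P" using back_cone_mono[OF assms(2)] back_cone_subset_closed_back_cone by blast
qed

lemma measure_lborel_cbox_pair:
  fixes a b c d :: real
  assumes "a \<le> b" "c \<le> d"
  shows "measure lborel (cbox (a, c) (b, d)) = (b - a) * (d - c)"
  using assms by (subst measure_lborel_cbox_eq) (auto simp: Basis_prod_def)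

text \<open>Gronwall's inequality by slabs: once \<open>f\<close> vanishes up to time \<open>j \<delta>\<close>, only the slab of height \<open>\<delta>\<close>
  above contributes to the integral, and for small \<open>\<delta>\<close> the maximum of \<open>f\<close> on the slab is at most half of
  itself.\<close>

lemma cone_gronwall:
  fixes f :: "real \<times> real \<Rightarrow> real"
  assumes f: "continuous_on (closed_back_cone P) f" "\<And>x. x \<in> closed_back_cone P \<Longrightarrow> 0 \<le> f x"
    and A: "0 \<le> A" "\<And>Q. Q \<in> closed_back_cone P \<Longrightarrow> f Q \<le> A * (LINT x:back_cone Q|lborel. f x)"
    and Q: "Q \<in> closed_back_cone P"
  shows "f Q = 0"
proof -
  have t0: "0 \<le> snd P" using Q by (auto simp: closed_back_cone_def)
  \<comment> \<open>The triangle has base \<open>2 * snd P\<close>; the summand \<open>1\<close> only avoids a division by \<open>0\<close>.\<close>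
  define \<delta> where "\<delta> = 1 / (2 * (A * (2 * snd P) + 1))"
  have "0 \<le> A * (2 * snd P)" using A(1) t0 by simp
  then have \<delta>: "0 < \<delta>" "A * (2 * snd P) * \<delta> \<le> 1 / 2" by (simp_all add: \<delta>_def divide_simps)
  have slab: "\<forall>Q\<in>closed_back_cone P. snd Q \<le> real j * \<delta> \<longrightarrow> f Q = 0" for j
  proof (induction j)
    case 0
    have "f Q = 0" if "Q \<in> closed_back_cone P" "snd Q \<le> 0" for Q
    proof -
      have "back_cone Q = {}" using that(2) by (auto simp: back_cone_def)
      then have "f Q \<le> 0" using A(2)[OF that(1)] by (simp add: set_lebesgue_integral_def)
      then show ?thesis using f(2)[OF that(1)] by simp
    qed
    then show ?case by simp
  next
    case (Suc j)
    show ?case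
    proof (intro ballI impI)
      fix Q assume Q: "Q \<in> closed_back_cone P" "snd Q \<le> real (Suc j) * \<delta>"
      define C where "C = closed_back_cone P \<inter> {x. snd x \<le> real (Suc j) * \<delta>}"
      have "closed {x::real\<times>real. snd x \<le> real (Suc j) * \<delta>}" by (intro closed_Collect_le continuous_intros)
      then have "compact C" unfolding C_def by (intro compact_Int_closed compact_closed_back_cone)
      moreover have "C \<noteq> {}" using Q by (auto simp: C_def)
      moreover have "continuous_on C f" using f(1) by (rule continuous_on_subset) (simp add: C_def)
      ultimately have "\<exists>m\<in>C. \<forall>y\<in>C. f y \<le> f m"
        by (rule continuous_attains_sup)
      then obtain m where m: "m \<in> C" "\<And>y. y \<in> C \<Longrightarrow> f y \<le> f m" by blast
      have mP: "m \<in> closed_back_cone P" using m(1) by (simp add: C_def)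
      have m0: "0 \<le> f m" using f(2)[OF mP] .
      define S where "S = cbox (fst P - snd P, real j * \<delta>) (fst P + snd P, real (Suc j) * \<delta>)"
      have S_eq: "S = {fst P - snd P..fst P + snd P} \<times> {real j * \<delta>..real (Suc j) * \<delta>}"
        unfolding S_def cbox_Pair_eq by simp
      have "measure lborel S = (fst P + snd P - (fst P - snd P)) * (real (Suc j) * \<delta> - real j * \<delta>)"
        unfolding S_def using t0 \<delta>(1) by (intro measure_lborel_cbox_pair) auto
      then have S: "measure lborel S = 2 * snd P * \<delta>" by (simp add: algebra_simps)
      have pt: "\<bar>indicator (back_cone m) x *\<^sub>R f x\<bar> \<le> f m * indicator S x" for x
      proof (cases "x \<in> back_cone m \<and> f x \<noteq> 0")
        case True
        then have xP: "x \<in> closed_back_cone P" using back_cone_mono[OF mP] back_cone_subset_closed_back_cone by blast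
        have "snd x < snd m" using True by (auto simp: back_cone_def)
        then have xC: "x \<in> C" using xP m(1) by (simp add: C_def)
        have "real j * \<delta> < snd x" using Suc.IH xP True by force
        then have "x \<in> S"
          using xP xC closed_back_cone_subset_cbox[of P] unfolding S_eq C_def cbox_Pair_eq
          by (auto simp: mem_Times_iff)
        then show ?thesis using True m(2)[OF xC] f(2)[OF xP] by simp
      next
        case False
        then show ?thesis using m0 by (auto simp: indicator_def)
      qed
      have "\<bar>LINT x:back_cone m|lborel. f x\<bar> \<le> f m * measure lborel S"
        unfolding set_lebesgue_integral_def
        by (rule integral_abs_le_measure[OF pt])
          (use m0 in \<open>simp_all add: S_def emeasure_lborel_cbox_finite[unfolded infinity_ennreal_def]\<close>)
      then have "A * (LINT x:back_cone m|lborel. f x) \<le> A * (f m * measure lborel S)"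
        using A(1) by (intro mult_left_mono) auto
      also have "\<dots> = (A * (2 * snd P) * \<delta>) * f m" unfolding S by (simp add: algebra_simps)
      also have "\<dots> \<le> 1 / 2 * f m" using \<delta>(2) m0 by (rule mult_right_mono)
      finally have "f m \<le> 0" using A(2)[OF mP] by simp
      moreover have "f Q \<le> f m" using m(2) Q by (simp add: C_def)
      ultimately show "f Q = 0" using f(2)[OF Q(1)] by simp
    qed
  qed
  obtain j :: nat where "snd Q / \<delta> < real j" using reals_Archimedean2 by blast
  then have "snd Q \<le> real j * \<delta>" using \<delta>(1) by (simp add: field_simps)
  then show ?thesis using slab Q by blast
qed

text \<open>Let \<open>H\<close> be the part of the right-hand side made of \<open>h\<close> and of the positive part of \<open>q\<close>, \<open>N\<close> the
  negative part of \<open>v\<close>, and \<open>\<kappa>' = \<kappa> / (fst P - snd P)\<^sup>2\<close>, a bound for the potential. Dropping the negative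
  part of \<open>q\<close> gives \<open>2 v \<le> H + \<kappa>' \<integral> N\<close>, and by monotonicity the value of this bound at \<open>Q\<close> holds on the whole
  triangle below \<open>Q\<close>. Inserted into the potential term of the equation at \<open>Q\<close>, it costs at most the
  bound itself, because \<open>\<kappa>'\<close> times the area of the triangle is at most \<open>2\<close>. So \<open>H\<close> cancels and
  \<open>2 v \<ge> - (M + \<kappa>') \<integral> N\<close> remains.\<close>

lemma cone_positivity:
  fixes v q :: "real \<times> real \<Rightarrow> real" and h :: "real \<Rightarrow> real"
  assumes \<xi>: "0 < fst P - snd P" and P: "0 \<le> snd P"
    and v: "continuous_on (closed_back_cone P) v" and q: "continuous_on (closed_back_cone P) q"
    and h: "continuous_on {fst P - snd P..fst P + snd P} h"
      "\<And>r. r \<in> {fst P - snd P..fst P + snd P} \<Longrightarrow> 0 \<le> h r"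
    and \<kappa>: "0 \<le> \<kappa>" "\<kappa> * (snd P)\<^sup>2 \<le> (fst P - snd P)\<^sup>2"
    and M: "0 \<le> M" "\<And>x. x \<in> closed_back_cone P \<Longrightarrow> - M * max 0 (- v x) \<le> q x"
    and rep: "\<And>Q. Q \<in> closed_back_cone P \<Longrightarrow>
      2 * v Q = (LINT r:{fst Q - snd Q<..<fst Q + snd Q}|lborel. h r)
        + (LINT x:back_cone Q|lborel. q x - \<kappa> / (fst x)\<^sup>2 * v x)"
  shows "0 \<le> v P"
proof -
  define C where "C = closed_back_cone P"
  define \<kappa>' where "\<kappa>' = \<kappa> / (fst P - snd P)\<^sup>2"
  define N where "N x = max 0 (- v x)" for x
  define q' where "q' x = max 0 (q x)" for x
  define k where "k x = \<kappa> / (fst x)\<^sup>2" for x :: "real \<times> real"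
  define Hh where "Hh Q = (LINT r:{fst Q - snd Q<..<fst Q + snd Q}|lborel. h r)" for Q :: "real \<times> real"
  define Hq where "Hq Q = (LINT x:back_cone Q|lborel. q' x)" for Q
  define LN where "LN Q = (LINT x:back_cone Q|lborel. N x)" for Q
  have \<kappa>'0: "0 \<le> \<kappa>'" using \<kappa>(1) by (simp add: \<kappa>'_def)
  have fstC: "fst P - snd P \<le> fst x" if "x \<in> C" for x using that by (auto simp: C_def closed_back_cone_def)
  have k: "0 \<le> k x" "k x \<le> \<kappa>'" if "x \<in> C" for x
  proof -
    show "0 \<le> k x" using \<kappa>(1) by (simp add: k_def)
    have "(fst P - snd P)\<^sup>2 \<le> (fst x)\<^sup>2" using fstC[OF that] \<xi> by (intro power_mono) auto
    then show "k x \<le> \<kappa>'" unfolding k_def \<kappa>'_def using \<kappa>(1) \<xi> fstC[OF that]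
      by (intro divide_left_mono mult_pos_pos zero_less_power) auto
  qed
  have cont: "continuous_on C N" "continuous_on C q'" "continuous_on C (\<lambda>x. q x - k x * v x)"
    using v q fstC \<xi> unfolding N_def q'_def k_def C_def by (force intro!: continuous_intros)+
  have coneC: "back_cone Q \<subseteq> C" if "Q \<in> C" for Q
    using that back_cone_mono[of Q P] back_cone_subset_closed_back_cone[of P] unfolding C_def by blast
  note I = set_integrable_cone[of P, folded C_def]
  have cm: "back_cone Q \<in> sets lborel" for Q using open_back_cone by simp
  have N0: "0 \<le> N x" and q'0: "0 \<le> q' x" for x by (simp_all add: N_def q'_def)
  have int_mono: "(LINT x:back_cone Y|lborel. f x) \<le> (LINT x:back_cone Q|lborel. f x)"
    if "continuous_on C f" "\<And>x. 0 \<le> f x" "Q \<in> C" "Y \<in> back_cone Q" for f :: "real \<times> real \<Rightarrow> real" and Y Q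
  proof -
    have "Y \<in> closed_back_cone Q" using that(4) back_cone_subset_closed_back_cone by blast
    then have "back_cone Y \<subseteq> back_cone Q" by (rule back_cone_mono)
    moreover have "set_integrable lborel (back_cone Y) f" "set_integrable lborel (back_cone Q) f"
      using I[OF that(1)] coneC[OF that(3)] that(3,4) by blast+
    ultimately show ?thesis
      unfolding set_lebesgue_integral_def set_integrable_def
      by (intro integral_mono) (use that(2) in \<open>auto simp: indicator_def\<close>)
  qed
  have hI: "set_integrable lborel {fst Q - snd Q<..<fst Q + snd Q} h"
    and hb: "\<And>r. r \<in> {fst Q - snd Q<..<fst Q + snd Q} \<Longrightarrow> 0 \<le> h r" if "Q \<in> C" for Q
  proof -
    have sub: "{fst Q - snd Q<..<fst Q + snd Q} \<subseteq> {fst P - snd P..fst P + snd P}"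
      using that by (auto simp: C_def closed_back_cone_def)
    show "\<And>r. r \<in> {fst Q - snd Q<..<fst Q + snd Q} \<Longrightarrow> 0 \<le> h r" using sub h(2) by blast
    show "set_integrable lborel {fst Q - snd Q<..<fst Q + snd Q} h"
      by (rule set_integrable_subset[OF _ _ sub])
        (use borel_integrable_compact[OF _ h(1)] in \<open>auto simp: set_integrable_def\<close>)
  qed
  have Hh_mono: "Hh Y \<le> Hh Q" if "Q \<in> C" "Y \<in> back_cone Q" for Q Y
  proof -
    have sub: "{fst Y - snd Y<..<fst Y + snd Y} \<subseteq> {fst Q - snd Q<..<fst Q + snd Q}"
      using that(2) by (auto simp: back_cone_def)
    have "Y \<in> C" using coneC[OF that(1)] that(2) by blast
    then show ?thesis
      using hI[OF that(1)] hI[of Y] unfolding Hh_def set_lebesgue_integral_def set_integrable_def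
      by (intro integral_mono) (use sub hb[OF that(1)] in \<open>auto simp: indicator_def\<close>)
  qed
  have nonneg: "0 \<le> Hh Q" "0 \<le> Hq Q" "0 \<le> LN Q" if "Q \<in> C" for Q
  proof -
    show "0 \<le> Hh Q" unfolding Hh_def set_lebesgue_integral_def
      by (rule Bochner_Integration.integral_nonneg) (use hb[OF that] in \<open>auto simp: indicator_def\<close>)
    show "0 \<le> Hq Q" "0 \<le> LN Q" unfolding Hq_def LN_def set_lebesgue_integral_def
      using N0 q'0 by (simp_all add: indicator_def)
  qed
  have upper: "2 * v Q \<le> Hh Q + Hq Q + \<kappa>' * LN Q" if Q: "Q \<in> C" for Q
  proof -
    have "(LINT x:back_cone Q|lborel. q x - k x * v x) \<le> (LINT x:back_cone Q|lborel. q' x + \<kappa>' * N x)"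
    proof (rule set_integral_mono)
      show "set_integrable lborel (back_cone Q) (\<lambda>x. q x - k x * v x)" using I[OF cont(3) Q] .
      show "set_integrable lborel (back_cone Q) (\<lambda>x. q' x + \<kappa>' * N x)"
        by (rule I[OF _ Q]) (intro continuous_intros cont)
      fix x assume "x \<in> back_cone Q"
      then have kx: "0 \<le> k x" "k x \<le> \<kappa>'" using k coneC[OF Q] by blast+
      have "- (k x * v x) \<le> \<kappa>' * N x"
      proof (cases "0 \<le> v x")
        case True
        have "0 \<le> k x * v x" "0 \<le> \<kappa>' * N x" using kx True \<kappa>'0 N0 by simp_all
        then show ?thesis by linarith
      next
        case False
        then have "k x * (- v x) \<le> \<kappa>' * (- v x)" using kx by (intro mult_right_mono) auto
        then show ?thesis using False by (simp add: N_def max_def)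
      qed
      then show "q x - k x * v x \<le> q' x + \<kappa>' * N x" by (simp add: q'_def)
    qed
    also have "\<dots> = Hq Q + \<kappa>' * LN Q"
      unfolding Hq_def LN_def
      by (subst set_integral_add(2)) (auto intro!: I[OF cont(2) Q] I[OF cont(1) Q] set_integrable_mult_right)
    finally show ?thesis using rep[of Q] Q unfolding Hh_def k_def C_def by linarith
  qed
  have lower: "N Q \<le> (M + \<kappa>') / 2 * LN Q" if Q: "Q \<in> C" for Q
  proof -
    \<comment> \<open>By monotonicity, the upper bound at \<open>Q\<close> bounds \<open>v\<close> on the whole triangle below \<open>Q\<close>.\<close>
    define W where "W = (Hh Q + Hq Q + \<kappa>' * LN Q) / 2"
    have W0: "0 \<le> W" using nonneg[OF Q] \<kappa>'0 by (simp add: W_def)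
    have vW: "v Y \<le> W" if Y: "Y \<in> back_cone Q" for Y
    proof -
      have YC: "Y \<in> C" using coneC[OF Q] Y by blast
      have le: "Hh Y \<le> Hh Q" "Hq Y \<le> Hq Q" "LN Y \<le> LN Q"
        unfolding Hq_def LN_def using Hh_mono int_mono[OF cont(2) q'0] int_mono[OF cont(1) N0] Q Y by auto
      have "2 * v Y \<le> Hh Y + Hq Y + \<kappa>' * LN Y" by (rule upper[OF YC])
      also have "\<dots> \<le> Hh Q + Hq Q + \<kappa>' * LN Q"
        by (intro add_mono mult_left_mono le \<kappa>'0)
      finally show ?thesis by (simp add: W_def)
    qed
    have "(LINT x:back_cone Q|lborel. q' x - M * N x - \<kappa>' * W) \<le> (LINT x:back_cone Q|lborel. q x - k x * v x)"
    proof (rule set_integral_mono)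
      show "set_integrable lborel (back_cone Q) (\<lambda>x. q x - k x * v x)" using I[OF cont(3) Q] .
      show "set_integrable lborel (back_cone Q) (\<lambda>x. q' x - M * N x - \<kappa>' * W)"
        by (rule I[OF _ Q]) (intro continuous_intros cont)
      fix x assume x: "x \<in> back_cone Q"
      then have xC: "x \<in> C" using coneC[OF Q] by blast
      have "k x * v x \<le> \<kappa>' * W"
      proof (cases "0 \<le> v x")
        case True
        then show ?thesis using k[OF xC] vW[OF x] by (intro mult_mono \<kappa>'0)
      next
        case False
        then have "k x * v x \<le> 0" using k(1)[OF xC] by (simp add: mult_nonneg_nonpos)
        moreover have "0 \<le> \<kappa>' * W" using \<kappa>'0 W0 by simp
        ultimately show ?thesis by linarith
      qed
      moreover have "q' x - M * N x \<le> q x"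
      proof -
        have "0 \<le> M * N x" using M(1) N0 by simp
        then show ?thesis using M(2)[of x] xC unfolding q'_def N_def C_def by (simp add: max_def split: if_splits)
      qed
      ultimately show "q' x - M * N x - \<kappa>' * W \<le> q x - k x * v x" by linarith
    qed
    moreover have "(LINT x:back_cone Q|lborel. q' x - M * N x - \<kappa>' * W)
        = Hq Q - M * LN Q - \<kappa>' * W * measure lborel (back_cone Q)"
    proof -
      have c: "set_integrable lborel (back_cone Q) (\<lambda>x. \<kappa>' * W)" by (rule I[OF _ Q]) simp
      have "(LINT x:back_cone Q|lborel. \<kappa>' * W) = \<kappa>' * W * measure lborel (back_cone Q)"
        by (simp add: set_lebesgue_integral_def mult.commute)
      then show ?thesis
        unfolding Hq_def LN_def
        by (simp add: set_integral_diff(2) c I[OF cont(2) Q] I[OF cont(1) Q] set_integrable_mult_right set_integral_diff(1))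
    qed
    \<comment> \<open>The triangle lies in a box of area \<open>2 (snd P)\<^sup>2\<close>; here the smallness assumption on \<open>\<kappa>\<close> is used.\<close>
    moreover have "\<kappa>' * W * measure lborel (back_cone Q) \<le> 2 * W"
    proof -
      have "back_cone Q \<subseteq> cbox (fst P - snd P, 0) (fst P + snd P, snd P)"
        using coneC[OF Q] closed_back_cone_subset_cbox[of P] unfolding C_def by blast
      then have "measure lborel (back_cone Q) \<le> measure lborel (cbox (fst P - snd P, 0) (fst P + snd P, snd P))"
        by (intro measure_mono_fmeasurable cm) (auto simp: fmeasurable_def emeasure_lborel_cbox_finite[unfolded infinity_ennreal_def])
      also have "\<dots> = (fst P + snd P - (fst P - snd P)) * (snd P - 0)"
        using P by (intro measure_lborel_cbox_pair) auto
      finally have "measure lborel (back_cone Q) \<le> 2 * (snd P)\<^sup>2" by (simp add: power2_eq_square)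
      then have "\<kappa>' * measure lborel (back_cone Q) \<le> \<kappa>' * (2 * (snd P)\<^sup>2)" using \<kappa>'0 by (rule mult_left_mono)
      also have "\<dots> \<le> 2" using \<kappa>(2) \<xi> by (simp add: \<kappa>'_def field_simps)
      finally have "W * (\<kappa>' * measure lborel (back_cone Q)) \<le> W * 2" using W0 by (rule mult_left_mono)
      then show ?thesis by (simp add: ac_simps)
    qed
    ultimately have "2 * v Q \<ge> Hh Q + (Hq Q - M * LN Q) - 2 * W"
      using rep[of Q] Q unfolding Hh_def k_def C_def by linarith
    then have "- v Q \<le> (M + \<kappa>') / 2 * LN Q" unfolding W_def by (simp add: field_simps)
    moreover have "0 \<le> (M + \<kappa>') / 2 * LN Q" using M(1) \<kappa>'0 nonneg(3)[OF Q] by simp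
    ultimately show ?thesis by (simp add: N_def)
  qed
  have "N P = 0"
  proof (rule cone_gronwall)
    show "continuous_on (closed_back_cone P) N" using cont(1) by (simp add: C_def)
    show "P \<in> closed_back_cone P" using P by (simp add: closed_back_cone_def)
    show "N Q \<le> (M + \<kappa>') / 2 * (LINT x:back_cone Q|lborel. N x)" if "Q \<in> closed_back_cone P" for Q
      using lower that unfolding LN_def C_def by blast
  qed (use N0 M(1) \<kappa>'0 in auto)
  then show ?thesis by (simp add: N_def max_def split: if_splits)
qed

section \<open>Test functions that approximate a characteristic triangle\<close>

text \<open>The first two factors are smooth steps of width \<open>1/m\<close> inside the two characteristics through \<open>P\<close>.
  The third one is \<open>1\<close> for \<open>t \<ge> 0\<close> and vanishes for \<open>t \<le> - (fst P - snd P) / 2\<close>, which makes the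
  support compact and keeps it in \<open>r > 0\<close>. The arguments are written as affine functions in the form of
  \<open>smooth_plane_affine\<close>.\<close>

definition cone_test :: "(nat \<Rightarrow> real \<Rightarrow> real) \<Rightarrow> real \<times> real \<Rightarrow> real \<Rightarrow> real \<times> real \<Rightarrow> real" where
  "cone_test H P m x = H 0 (- (m * (fst P - snd P)) + m * fst x + - m * snd x)
     * H 0 (m * (fst P + snd P) + - m * fst x + - m * snd x)
     * H 0 (1 + 0 * fst x + 2 / (fst P - snd P) * snd x)"

text \<open>The image of \<open>cone_test\<close> under the wave operator for \<open>t > 0\<close>: an approximate point mass at \<open>P\<close> of total mass \<open>2\<close>.\<close>

definition cone_kernel :: "(nat \<Rightarrow> real \<Rightarrow> real) \<Rightarrow> real \<times> real \<Rightarrow> real \<Rightarrow> real \<times> real \<Rightarrow> real" where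
  "cone_kernel H P m x = 4 * m\<^sup>2 * (H (Suc 0) (- (m * (fst P - snd P)) + m * fst x + - m * snd x)
     * H (Suc 0) (m * (fst P + snd P) + - m * fst x + - m * snd x))"

context
  fixes H :: "nat \<Rightarrow> real \<Rightarrow> real"
  assumes H: "smooth_step H"
begin

lemma step_deriv: "(H k has_real_derivative H (Suc k) x) (at x)"
  using H by (simp add: smooth_step_def smooth_line_def)

lemma step_continuous: "continuous_on A (H k)"
  using H smooth_line_continuous by (simp add: smooth_step_def)

lemma step_zero: "x \<le> 0 \<Longrightarrow> H 0 x = 0" and step_one: "1 \<le> x \<Longrightarrow> H 0 x = 1"
  and step_bounds: "0 \<le> H 0 x" "H 0 x \<le> 1" and step_deriv_nonneg: "0 \<le> H (Suc 0) x"
  and step_deriv_zero: "x \<le> 0 \<or> 1 \<le> x \<Longrightarrow> H (Suc 0) x = 0"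
  using H by (auto simp: smooth_step_def)

lemma step_deriv2_zero:
  assumes "1 < x" shows "H (Suc (Suc 0)) x = 0"
proof -
  have "eventually (\<lambda>y. H (Suc 0) y = 0) (nhds x)"
    by (rule eventually_mono[OF eventually_nhds_in_open[of "{1<..}" x]])
      (use assms in \<open>auto intro: step_deriv_zero\<close>)
  from DERIV_cong_ev[OF refl this refl] have "(H (Suc 0) has_real_derivative 0) (at x)" by simp
  then show ?thesis using DERIV_unique[OF step_deriv] by blast
qed

lemma step_mass_affine:
  assumes "a \<noteq> 0"
  shows "(\<integral>\<^sup>+ x. ennreal (H (Suc 0) (c + a * x)) \<partial>lborel) = ennreal (1 / \<bar>a\<bar>)"
proof -
  have meas: "(\<lambda>x. ennreal (H (Suc 0) x)) \<in> borel_measurable borel"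
    using borel_measurable_continuous_onI[OF step_continuous] by simp
  have "(\<integral>\<^sup>+ x. ennreal (H (Suc 0) x) \<partial>lborel) = (\<integral>\<^sup>+ x. ennreal (H (Suc 0) x) * indicator {0..1} x \<partial>lborel)"
    by (intro nn_integral_cong) (auto simp: indicator_def step_deriv_zero)
  also have "\<dots> = ennreal (H 0 1 - H 0 0)"
    by (intro nn_integral_FTC_Icc step_deriv_nonneg)
      (auto intro!: borel_measurable_continuous_onI step_continuous has_field_derivative_at_within[OF step_deriv])
  also have "\<dots> = 1" by (simp add: step_zero step_one)
  finally have "1 = ennreal \<bar>a\<bar> * (\<integral>\<^sup>+ x. ennreal (H (Suc 0) (c + a * x)) \<partial>lborel)"
    using nn_integral_real_affine[OF meas assms, of c] by simp
  then have "ennreal (1 / \<bar>a\<bar>) * 1 = (ennreal (1 / \<bar>a\<bar>) * ennreal \<bar>a\<bar>) * (\<integral>\<^sup>+ x. ennreal (H (Suc 0) (c + a * x)) \<partial>lborel)"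
    by (simp add: mult.assoc)
  moreover have "ennreal (1 / \<bar>a\<bar>) * ennreal \<bar>a\<bar> = 1"
    using assms by (subst ennreal_mult[symmetric]) auto
  ultimately show ?thesis by simp
qed

text \<open>Shifting \<open>r\<close> by \<open>t\<close> makes the first factor independent of \<open>t\<close>, so that after an exchange of the
  integrals both can be evaluated one after the other. The factor \<open>1/2\<close> is the Jacobian of the
  characteristic coordinates.\<close>

lemma characteristic_kernel_mass:
  assumes "0 < m"
  shows "(\<integral>\<^sup>+ x. ennreal (H (Suc 0) (a + m * fst x + - m * snd x) * H (Suc 0) (b + - m * fst x + - m * snd x))
      \<partial>(lborel :: (real \<times> real) measure)) = ennreal (1 / (2 * m\<^sup>2))"
proof -
  let ?\<rho> = "\<lambda>x. ennreal (H (Suc 0) x)"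
  have [measurable]: "H (Suc 0) \<in> borel_measurable borel"
    by (intro borel_measurable_continuous_onI step_continuous)
  have "(\<integral>\<^sup>+ x. ennreal (H (Suc 0) (a + m * fst x + - m * snd x) * H (Suc 0) (b + - m * fst x + - m * snd x))
      \<partial>(lborel :: (real \<times> real) measure))
    = (\<integral>\<^sup>+ t. \<integral>\<^sup>+ r. ?\<rho> (a + m * r + - m * t) * ?\<rho> (b + - m * r + - m * t) \<partial>lborel \<partial>lborel)"
    unfolding lborel_prod[symmetric]
    by (subst lborel_pair.nn_integral_snd[symmetric]) (simp_all add: ennreal_mult step_deriv_nonneg)
  also have "\<dots> = (\<integral>\<^sup>+ t. \<integral>\<^sup>+ r. ?\<rho> (a + m * r) * ?\<rho> (b + - m * r + - (2 * m) * t) \<partial>lborel \<partial>lborel)"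
  proof (rule nn_integral_cong)
    fix t :: real
    show "(\<integral>\<^sup>+ r. ?\<rho> (a + m * r + - m * t) * ?\<rho> (b + - m * r + - m * t) \<partial>lborel)
        = (\<integral>\<^sup>+ r. ?\<rho> (a + m * r) * ?\<rho> (b + - m * r + - (2 * m) * t) \<partial>lborel)"
      by (subst nn_integral_real_affine[where c = 1 and t = t]) (auto simp: algebra_simps)
  qed
  also have "\<dots> = (\<integral>\<^sup>+ r. \<integral>\<^sup>+ t. ?\<rho> (a + m * r) * ?\<rho> (b + - m * r + - (2 * m) * t) \<partial>lborel \<partial>lborel)"
    by (rule lborel_pair.Fubini') simp
  also have "\<dots> = (\<integral>\<^sup>+ r. ?\<rho> (a + m * r) * ennreal (1 / (2 * m)) \<partial>lborel)"
    by (intro nn_integral_cong, subst nn_integral_cmult)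
      (use step_mass_affine[of "- (2 * m)"] assms in auto)
  also have "\<dots> = ennreal (1 / m) * ennreal (1 / (2 * m))"
    by (subst nn_integral_multc) (use step_mass_affine[of m a] assms in auto)
  also have "\<dots> = ennreal (1 / (2 * m\<^sup>2))"
    using assms by (subst ennreal_mult[symmetric]) (auto simp: power2_eq_square)
  finally show ?thesis .
qed

lemma smooth_plane_cone_test: "smooth_plane (cone_test H P m)"
proof -
  have "smooth_line H" using H by (simp add: smooth_step_def)
  then show ?thesis
    unfolding cone_test_def[abs_def] by (intro smooth_plane_mult smooth_plane_affine)
qed

text \<open>In \<open>(\<partial>\<^sub>t\<^sup>2 - \<partial>\<^sub>r\<^sup>2) (a(r-t) b(r+t))\<close> only the mixed term survives. The third factor is locally
  constant for \<open>t > 0\<close>.\<close>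

lemma cone_test_wave_operator:
  assumes "0 < snd x" "0 < fst P - snd P"
  shows "pd_t (pd_t (cone_test H P m)) x - pd_r (pd_r (cone_test H P m)) x = cone_kernel H P m x"
proof -
  define d where "d = 2 / (fst P - snd P)"
  define a where "a = - (m * (fst P - snd P))"
  define b where "b = m * (fst P + snd P)"
  define A B Z where "A k r t = H k (a + m * r + - m * t)"
    and "B k r t = H k (b + - m * r + - m * t)" and "Z k r t = H k (1 + 0 * r + d * t)" for k r t
  have At: "((\<lambda>s. A k r s) has_real_derivative (- m) * A (Suc k) r t) (at t)"
    and Bt: "((\<lambda>s. B k r s) has_real_derivative (- m) * B (Suc k) r t) (at t)"
    and Zt: "((\<lambda>s. Z k r s) has_real_derivative d * Z (Suc k) r t) (at t)"
    and Ar: "((\<lambda>s. A k s t) has_real_derivative m * A (Suc k) r t) (at r)"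
    and Br: "((\<lambda>s. B k s t) has_real_derivative (- m) * B (Suc k) r t) (at r)"
    and Zr: "((\<lambda>s. Z k s t) has_real_derivative 0) (at r)" for k r t
    unfolding A_def B_def Z_def
    by (rule DERIV_cong, rule DERIV_chain2[OF step_deriv], (auto intro!: derivative_eq_intros)[1], simp)+
  have f: "cone_test H P m (r, t) = A 0 r t * B 0 r t * Z 0 r t" for r t
    by (simp add: cone_test_def A_def B_def Z_def a_def b_def d_def)
  have t1: "pd_t (cone_test H P m) (r, t)
      = (- m * A (Suc 0) r t * B 0 r t + - m * B (Suc 0) r t * A 0 r t) * Z 0 r t + d * Z (Suc 0) r t * (A 0 r t * B 0 r t)"
    for r t
    unfolding pd_t_def f prod.case by (intro DERIV_imp_deriv DERIV_mult At Bt Zt)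
  have r1: "pd_r (cone_test H P m) (r, t)
      = (m * A (Suc 0) r t * B 0 r t + - m * B (Suc 0) r t * A 0 r t) * Z 0 r t + 0 * (A 0 r t * B 0 r t)"
    for r t
    unfolding pd_r_def f prod.case by (intro DERIV_imp_deriv DERIV_mult Ar Br Zr)
  obtain r t where x: "x = (r, t)" by (cases x)
  have "0 < d * t" using assms by (simp add: d_def x)
  then have Z: "Z 0 r t = 1" "Z (Suc 0) r t = 0" "Z (Suc (Suc 0)) r t = 0"
    by (simp_all add: Z_def step_one step_deriv_zero step_deriv2_zero)
  \<comment> \<open>The derivatives are written in exactly the form which the sum and product rules produce.\<close>
  have "((\<lambda>s. (- m * A (Suc 0) r s * B 0 r s + - m * B (Suc 0) r s * A 0 r s) * Z 0 r s + d * Z (Suc 0) r s * (A 0 r s * B 0 r s))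
     has_real_derivative
      (((- m * (- m * A (Suc (Suc 0)) r t)) * B 0 r t + (- m * B (Suc 0) r t) * (- m * A (Suc 0) r t))
       + ((- m * (- m * B (Suc (Suc 0)) r t)) * A 0 r t + (- m * A (Suc 0) r t) * (- m * B (Suc 0) r t))) * Z 0 r t
      + d * Z (Suc 0) r t * (- m * A (Suc 0) r t * B 0 r t + - m * B (Suc 0) r t * A 0 r t)
      + ((d * (d * Z (Suc (Suc 0)) r t)) * (A 0 r t * B 0 r t)
         + ((- m * A (Suc 0) r t) * B 0 r t + (- m * B (Suc 0) r t) * A 0 r t) * (d * Z (Suc 0) r t))) (at t)"
    by (intro DERIV_add DERIV_mult DERIV_cmult At Bt Zt)
  then have t2: "pd_t (pd_t (cone_test H P m)) x
      = m\<^sup>2 * (A (Suc (Suc 0)) r t * B 0 r t + 2 * A (Suc 0) r t * B (Suc 0) r t + A 0 r t * B (Suc (Suc 0)) r t)"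
    unfolding x pd_t_def[of "pd_t _"] t1 prod.case
    by (subst DERIV_imp_deriv, assumption) (simp add: Z power2_eq_square algebra_simps)
  have "((\<lambda>s. (m * A (Suc 0) s t * B 0 s t + - m * B (Suc 0) s t * A 0 s t) * Z 0 s t + 0 * (A 0 s t * B 0 s t))
     has_real_derivative
      (((m * (m * A (Suc (Suc 0)) r t)) * B 0 r t + (- m * B (Suc 0) r t) * (m * A (Suc 0) r t))
       + ((- m * (- m * B (Suc (Suc 0)) r t)) * A 0 r t + (m * A (Suc 0) r t) * (- m * B (Suc 0) r t))) * Z 0 r t
      + 0 * (m * A (Suc 0) r t * B 0 r t + - m * B (Suc 0) r t * A 0 r t)
      + 0 * ((m * A (Suc 0) r t) * B 0 r t + (- m * B (Suc 0) r t) * A 0 r t)) (at r)"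
    by (intro DERIV_add DERIV_mult DERIV_cmult Ar Br Zr)
  then have r2: "pd_r (pd_r (cone_test H P m)) x
      = m\<^sup>2 * (A (Suc (Suc 0)) r t * B 0 r t - 2 * A (Suc 0) r t * B (Suc 0) r t + A 0 r t * B (Suc (Suc 0)) r t)"
    unfolding x pd_r_def[of "pd_r _"] r1 prod.case
    by (subst DERIV_imp_deriv, assumption) (simp add: Z power2_eq_square algebra_simps)
  have "cone_kernel H P m x = 4 * m\<^sup>2 * (A (Suc 0) r t * B (Suc 0) r t)"
    by (simp add: cone_kernel_def A_def B_def a_def b_def x)
  then show ?thesis unfolding t2 r2 by (simp add: algebra_simps)
qed

end

section \<open>The formula of d'Alembert for weak solutions\<close>

context
  fixes H :: "nat \<Rightarrow> real \<Rightarrow> real" and P :: "real \<times> real"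
  assumes H: "smooth_step H" and \<xi>: "0 < fst P - snd P"
begin

lemma cone_test_bounds: "0 \<le> cone_test H P m x" "cone_test H P m x \<le> 1"
  unfolding cone_test_def using step_bounds[OF H]
  by (intro mult_nonneg_nonneg mult_le_one; simp)+

lemma cone_test_zero:
  assumes "0 \<le> m"
    and "\<not> (fst P - snd P \<le> fst x - snd x \<and> fst x + snd x \<le> fst P + snd P \<and> - ((fst P - snd P) / 2) \<le> snd x)"
  shows "cone_test H P m x = 0"
proof -
  consider "fst x - snd x \<le> fst P - snd P" | "fst P + snd P \<le> fst x + snd x" | "snd x \<le> - ((fst P - snd P) / 2)"
    using assms(2) by linarith
  then show ?thesis
  proof cases
    case 1
    then have "m * (fst x - snd x) \<le> m * (fst P - snd P)" using assms(1) by (rule mult_left_mono)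
    then have "- (m * (fst P - snd P)) + m * fst x + - m * snd x \<le> 0" by (simp add: algebra_simps)
    then show ?thesis by (simp add: cone_test_def step_zero[OF H])
  next
    case 2
    then have "m * (fst P + snd P) \<le> m * (fst x + snd x)" using assms(1) by (rule mult_left_mono)
    then have "m * (fst P + snd P) + - m * fst x + - m * snd x \<le> 0" by (simp add: algebra_simps)
    then show ?thesis by (simp add: cone_test_def step_zero[OF H])
  next
    case 3
    then have "1 + 0 * fst x + 2 / (fst P - snd P) * snd x \<le> 0" using \<xi> by (simp add: field_simps)
    then show ?thesis unfolding cone_test_def by (simp only: step_zero[OF H] mult_zero_right)
  qed
qed

lemma cone_test_zero_outside: "0 \<le> m \<Longrightarrow> 0 \<le> snd x \<Longrightarrow> x \<notin> closed_back_cone P \<Longrightarrow> cone_test H P m x = 0"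
  by (rule cone_test_zero) (auto simp: closed_back_cone_def)

lemma cone_test_limit:
  assumes "0 \<le> snd x"
  shows "(\<lambda>m. cone_test H P (real m) x) \<longlonglongrightarrow>
    (if fst P - snd P < fst x - snd x \<and> fst x + snd x < fst P + snd P then 1 else 0)"
proof (cases "fst P - snd P < fst x - snd x \<and> fst x + snd x < fst P + snd P")
  case True
  define a where "a = min (fst x - snd x - (fst P - snd P)) (fst P + snd P - (fst x + snd x))"
  have a: "0 < a" using True by (simp add: a_def)
  obtain N :: nat where N: "1 / a < real N" using reals_Archimedean2 by blast
  have "cone_test H P (real m) x = 1" if "N \<le> m" for m
  proof -
    have "1 / a < real m" using N that by linarith
    then have 1: "1 \<le> real m * a" using a by (simp add: field_simps)
    have "real m * a \<le> real m * (fst x - snd x - (fst P - snd P))"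
      "real m * a \<le> real m * (fst P + snd P - (fst x + snd x))"
      by (intro mult_left_mono; simp add: a_def)+
    then have "1 \<le> - (real m * (fst P - snd P)) + real m * fst x + - real m * snd x"
      "1 \<le> real m * (fst P + snd P) + - real m * fst x + - real m * snd x"
      using 1 by (simp_all add: algebra_simps)
    moreover have "1 \<le> 1 + 0 * fst x + 2 / (fst P - snd P) * snd x" using assms \<xi> by simp
    ultimately show ?thesis unfolding cone_test_def by (simp only: step_one[OF H] mult_1_left)
  qed
  then have "(\<lambda>m. cone_test H P (real m) x) \<longlonglongrightarrow> 1"
    by (intro tendsto_eventually eventually_sequentiallyI[of N])
  then show ?thesis using True by simp
next
  case False
  have "cone_test H P (real m) x = 0" for m
  proof (cases "fst x - snd x \<le> fst P - snd P")
    case True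
    then have "real m * (fst x - snd x) \<le> real m * (fst P - snd P)" by (rule mult_left_mono) simp
    then have "- (real m * (fst P - snd P)) + real m * fst x + - real m * snd x \<le> 0" by (simp add: algebra_simps)
    then show ?thesis by (simp add: cone_test_def step_zero[OF H])
  next
    case False2: False
    then have "fst P + snd P \<le> fst x + snd x" using False by linarith
    then have "real m * (fst P + snd P) \<le> real m * (fst x + snd x)" by (rule mult_left_mono) simp
    then have "real m * (fst P + snd P) + - real m * fst x + - real m * snd x \<le> 0" by (simp add: algebra_simps)
    then show ?thesis by (simp add: cone_test_def step_zero[OF H])
  qed
  then show ?thesis unfolding if_not_P[OF False] by simp
qed

lemma cone_test_continuous: "continuous_on A (cone_test H P m)"
  using smooth_plane_cone_test[OF H, of P m] smooth_familyD(1) unfolding smooth_plane_iff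
  by (metis continuous_on_subset subset_UNIV)

text \<open>Dominated convergence: on \<open>t > 0\<close> the test functions are bounded by the indicator function of the
  closed triangle and tend pointwise to that of the open one.\<close>

lemma cone_test_integral_limit:
  assumes F: "continuous_on (closed_back_cone P) F"
    and U: "open U" "back_cone P \<subseteq> U" "U \<subseteq> {x. 0 < snd x}"
  shows "set_integrable lborel U (\<lambda>x. F x * cone_test H P (real m) x)"
    and "(\<lambda>m. LINT x:U|lborel. F x * cone_test H P (real m) x) \<longlonglongrightarrow> (LINT x:back_cone P|lborel. F x)"
proof -
  define s where "s m x = indicator U x *\<^sub>R (F x * cone_test H P (real m) x)" for m x
  define f where "f x = indicator (back_cone P) x *\<^sub>R F x" for x
  define w where "w x = norm (indicator (closed_back_cone P) x *\<^sub>R F x)" for x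
  have FI: "integrable lborel (\<lambda>x. indicator (closed_back_cone P) x *\<^sub>R F x)"
    by (rule borel_integrable_compact[OF compact_closed_back_cone F])
  have w: "integrable lborel w" unfolding w_def using FI by (rule integrable_norm)
  have zero: "cone_test H P (real m) x = 0" if "x \<in> U" "x \<notin> closed_back_cone P" for m x
  proof (rule cone_test_zero_outside)
    show "0 \<le> snd x" using that(1) U(3) by (auto intro: less_imp_le)
  qed (use that in simp_all)
  have s: "s m \<in> borel_measurable lborel" for m
  proof -
    have "(\<lambda>x. indicator U x *\<^sub>R cone_test H P (real m) x) \<in> borel_measurable borel"
      by (intro borel_measurable_continuous_on_indicator cone_test_continuous borel_open U)
    then have "(\<lambda>x. (indicator (closed_back_cone P) x *\<^sub>R F x) * (indicator U x *\<^sub>R cone_test H P (real m) x))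
        \<in> borel_measurable lborel"
      using borel_measurable_integrable[OF FI] by (intro borel_measurable_times) simp_all
    moreover have "s m x = (indicator (closed_back_cone P) x *\<^sub>R F x) * (indicator U x *\<^sub>R cone_test H P (real m) x)" for x
      using zero[of x m] by (auto simp: s_def indicator_def)
    ultimately show ?thesis by (simp cong: measurable_cong)
  qed
  have lim: "(\<lambda>m. s m x) \<longlonglongrightarrow> f x" for x
  proof (cases "x \<in> U")
    case True
    then have "0 < snd x" using U(3) by blast
    then have "(\<lambda>m. F x * cone_test H P (real m) x) \<longlonglongrightarrow> F x * indicator (back_cone P) x"
    proof (intro tendsto_mult tendsto_const)
      have eq: "indicator (back_cone P) x =
          (if fst P - snd P < fst x - snd x \<and> fst x + snd x < fst P + snd P then 1 else (0::real))"
        using \<open>0 < snd x\<close> by (simp add: indicator_def back_cone_def)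
      show "(\<lambda>m. cone_test H P (real m) x) \<longlonglongrightarrow> indicator (back_cone P) x"
        unfolding eq using \<open>0 < snd x\<close> by (intro cone_test_limit) simp
    qed
    then show ?thesis using True by (simp add: s_def f_def mult.commute)
  next
    case False
    then show ?thesis using U(2) by (auto simp: s_def f_def indicator_def)
  qed
  have bound: "norm (s m x) \<le> w x" for m x
    using zero[of x m] cone_test_bounds[of "real m" x] mult_left_mono[of "cone_test H P (real m) x" 1 "\<bar>F x\<bar>"]
    by (auto simp: s_def w_def indicator_def abs_mult)
  have f: "f \<in> borel_measurable lborel" by (rule borel_measurable_LIMSEQ_real[OF lim s])
  show "(\<lambda>m. LINT x:U|lborel. F x * cone_test H P (real m) x) \<longlonglongrightarrow> (LINT x:back_cone P|lborel. F x)"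
    using integral_dominated_convergence[OF f s w AE_I2[OF lim] AE_I2[OF bound]]
    unfolding set_lebesgue_integral_def s_def f_def .
  show "set_integrable lborel U (\<lambda>x. F x * cone_test H P (real m) x)"
    using Bochner_Integration.integrable_bound[OF w s[of m]] bound[of m] unfolding set_integrable_def s_def by (simp add: w_def)
qed

lemma cone_test_initial_integral_limit:
  assumes h: "continuous_on {fst P - snd P..fst P + snd P} h" and R: "R < fst P - snd P"
  shows "(\<lambda>m. LINT r:{R<..}|lborel. h r * cone_test H P (real m) (r, 0))
    \<longlonglongrightarrow> (LINT r:{fst P - snd P<..<fst P + snd P}|lborel. h r)"
proof -
  define I where "I = {fst P - snd P..fst P + snd P}"
  define s where "s m r = indicator {R<..} r *\<^sub>R (h r * cone_test H P (real m) (r, 0))" for m r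
  define f where "f r = indicator {fst P - snd P<..<fst P + snd P} r *\<^sub>R h r" for r
  define w where "w r = norm (indicator I r *\<^sub>R h r)" for r
  have hI: "integrable lborel (\<lambda>r. indicator I r *\<^sub>R h r)"
    unfolding I_def by (rule borel_integrable_compact[OF compact_Icc h])
  have w: "integrable lborel w" unfolding w_def using hI by (rule integrable_norm)
  have zero: "cone_test H P (real m) (r, 0) = 0" if "r \<notin> I" for m r
    using cone_test_zero_outside[of "real m" "(r, 0)"] that by (auto simp: closed_back_cone_def I_def)
  have s_eq: "s m r = (indicator I r *\<^sub>R h r) * cone_test H P (real m) (r, 0)" for m r
    using zero[of r m] R by (auto simp: s_def indicator_def I_def)
  have s: "s m \<in> borel_measurable lborel" for m
  proof -
    have "continuous_on UNIV (\<lambda>r. cone_test H P (real m) (r, 0))"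
      by (rule continuous_on_compose2[OF cone_test_continuous[of UNIV]]) (auto intro!: continuous_intros)
    then have "(\<lambda>r. cone_test H P (real m) (r, 0)) \<in> borel_measurable lborel"
      using borel_measurable_continuous_onI by simp
    then show ?thesis
      unfolding s_eq[abs_def] using borel_measurable_integrable[OF hI] by (intro borel_measurable_times)
  qed
  have lim: "(\<lambda>m. s m r) \<longlonglongrightarrow> f r" for r
  proof -
    have "(\<lambda>m. (indicator I r *\<^sub>R h r) * cone_test H P (real m) (r, 0)) \<longlonglongrightarrow>
      (indicator I r *\<^sub>R h r) * indicator {fst P - snd P<..<fst P + snd P} r"
    proof (intro tendsto_mult tendsto_const)
      show "(\<lambda>m. cone_test H P (real m) (r, 0)) \<longlonglongrightarrow> indicator {fst P - snd P<..<fst P + snd P} r"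
        using cone_test_limit[of "(r, 0)"] by (simp only: indicator_def of_bool_def fst_conv snd_conv
            greaterThanLessThan_iff order_refl diff_0_right add_0_right)
    qed
    moreover have "(indicator I r *\<^sub>R h r) * indicator {fst P - snd P<..<fst P + snd P} r = f r"
      by (auto simp: f_def indicator_def I_def)
    ultimately show ?thesis by (simp only: s_eq)
  qed
  have bound: "norm (s m r) \<le> w r" for m r
    unfolding s_eq w_def
    using cone_test_bounds[of "real m" "(r, 0)"] mult_left_mono[of "cone_test H P (real m) (r, 0)" 1 "\<bar>h r\<bar>"]
    by (auto simp: indicator_def abs_mult)
  have f: "f \<in> borel_measurable lborel" by (rule borel_measurable_LIMSEQ_real[OF lim s])
  show ?thesis
    using integral_dominated_convergence[OF f s w AE_I2[OF lim] AE_I2[OF bound]]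
    unfolding set_lebesgue_integral_def s_def f_def .
qed

lemma cone_kernel_nonneg: "0 \<le> cone_kernel H P m x"
  unfolding cone_kernel_def using step_deriv_nonneg[OF H] by (intro mult_nonneg_nonneg) auto

lemma cone_kernel_continuous: "continuous_on A (cone_kernel H P m)"
  unfolding cone_kernel_def[abs_def]
  by (intro continuous_intros continuous_on_compose2[OF step_continuous[OF H, of UNIV]]) auto

text \<open>The kernel lives where both characteristic coordinates are within \<open>1/m\<close> of those of \<open>P\<close>, hence
  within \<open>1/m\<close> of \<open>P\<close> in each Cartesian coordinate.\<close>

lemma cone_kernel_zero:
  assumes m: "0 < m" and x: "cone_kernel H P m x \<noteq> 0"
  shows "\<bar>fst x - fst P\<bar> \<le> 1 / m" "\<bar>snd x - snd P\<bar> \<le> 1 / m"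
proof -
  have "\<not> (- (m * (fst P - snd P)) + m * fst x + - m * snd x \<le> 0 \<or> 1 \<le> - (m * (fst P - snd P)) + m * fst x + - m * snd x)"
    "\<not> (m * (fst P + snd P) + - m * fst x + - m * snd x \<le> 0 \<or> 1 \<le> m * (fst P + snd P) + - m * fst x + - m * snd x)"
    using x step_deriv_zero[OF H] unfolding cone_kernel_def by (metis mult_zero_left mult_zero_right)+
  then have "0 < m * (fst x - snd x - (fst P - snd P))" "m * (fst x - snd x - (fst P - snd P)) < 1"
    "0 < m * (fst P + snd P - (fst x + snd x))" "m * (fst P + snd P - (fst x + snd x)) < 1"
    by (simp_all add: algebra_simps)
  moreover have "0 < y \<and> y < 1 / m" if "0 < m * y" "m * y < 1" for y
    using that m by (simp add: zero_less_mult_iff pos_less_divide_eq mult.commute)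
  ultimately have "0 < fst x - snd x - (fst P - snd P)" "fst x - snd x - (fst P - snd P) < 1 / m"
    "0 < fst P + snd P - (fst x + snd x)" "fst P + snd P - (fst x + snd x) < 1 / m"
    by blast+
  then show "\<bar>fst x - fst P\<bar> \<le> 1 / m" "\<bar>snd x - snd P\<bar> \<le> 1 / m"
    by linarith+
qed

lemma cone_kernel_integral:
  assumes "0 < m"
  shows "integrable lborel (cone_kernel H P m)" "(LINT x|lborel. cone_kernel H P m x) = 2"
proof -
  define \<rho> where "\<rho> x = H (Suc 0) (- (m * (fst P - snd P)) + m * fst x + - m * snd x)
     * H (Suc 0) (m * (fst P + snd P) + - m * fst x + - m * snd x)" for x
  have nn: "0 \<le> \<rho> x" for x unfolding \<rho>_def using step_deriv_nonneg[OF H] by simp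
  have c: "continuous_on UNIV \<rho>"
    unfolding \<rho>_def[abs_def]
    by (intro continuous_intros continuous_on_compose2[OF step_continuous[OF H, of UNIV]]) auto
  have "(\<integral>\<^sup>+ x. ennreal (\<rho> x) \<partial>lborel) = ennreal (1 / (2 * m\<^sup>2))"
    unfolding \<rho>_def by (rule characteristic_kernel_mass[OF H assms])
  then have *: "has_bochner_integral lborel \<rho> (1 / (2 * m\<^sup>2))"
    using nn borel_measurable_continuous_onI[OF c] by (intro has_bochner_integral_nn_integral) auto
  have eq: "cone_kernel H P m = (\<lambda>x. 4 * m\<^sup>2 * \<rho> x)" by (simp add: cone_kernel_def \<rho>_def fun_eq_iff)
  have "has_bochner_integral lborel (cone_kernel H P m) (4 * m\<^sup>2 * (1 / (2 * m\<^sup>2)))"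
    unfolding eq using * by (intro has_bochner_integral_mult_right) auto
  then show "integrable lborel (cone_kernel H P m)" "(LINT x|lborel. cone_kernel H P m x) = 2"
    using assms by (auto simp: has_bochner_integral_iff)
qed

text \<open>The kernel is an approximate identity: it is nonnegative, has mass \<open>2\<close>, and its support shrinks to \<open>P\<close>.
  Integrability holds as soon as the support is contained in \<open>U\<close>.\<close>

lemma cone_kernel_limit:
  assumes U: "open U" "P \<in> U" and v: "continuous_on U v"
  shows "eventually (\<lambda>m. set_integrable lborel U (\<lambda>x. v x * cone_kernel H P (real m) x)) sequentially"
    and "(\<lambda>m. LINT x:U|lborel. v x * cone_kernel H P (real m) x) \<longlonglongrightarrow> 2 * v P"
proof -
  have close: "\<exists>N. \<forall>m\<ge>N. set_integrable lborel U (\<lambda>x. v x * cone_kernel H P (real m) x) \<and>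
      \<bar>(LINT x:U|lborel. v x * cone_kernel H P (real m) x) - 2 * v P\<bar> \<le> 2 * e" if e: "0 < e" for e
  proof -
    obtain d1 where d1: "0 < d1" "ball P d1 \<subseteq> U" using U open_contains_ball by blast
    obtain d2 where d2: "0 < d2" "\<And>x. x \<in> U \<Longrightarrow> dist x P < d2 \<Longrightarrow> dist (v x) (v P) < e"
      using v U(2) e unfolding continuous_on_iff by blast
    obtain N :: nat where N: "2 / min d1 d2 < real N" using reals_Archimedean2 by blast
    have "set_integrable lborel U (\<lambda>x. v x * cone_kernel H P (real m) x) \<and>
      \<bar>(LINT x:U|lborel. v x * cone_kernel H P (real m) x) - 2 * v P\<bar> \<le> 2 * e" if "N \<le> m" for m
    proof -
      define J where "J = cone_kernel H P (real m)"
      define f where "f x = indicator U x *\<^sub>R (v x * J x)" for x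
      have "2 / min d1 d2 < real m" "0 < 2 / min d1 d2" using N that d1(1) d2(1) by auto
      then have "0 < real m" by linarith
      moreover have "0 < min d1 d2" using d1(1) d2(1) by simp
      ultimately have m: "0 < real m" "2 / real m < min d1 d2"
        using \<open>2 / min d1 d2 < real m\<close> by (simp_all only: pos_divide_less_eq mult.commute)
      have near: "x \<in> U \<and> \<bar>v x - v P\<bar> \<le> e" if "J x \<noteq> 0" for x
      proof -
        have "dist x P \<le> dist (fst x) (fst P) + dist (snd x) (snd P)"
          by (simp add: dist_prod_def sqrt_sum_squares_le_sum)
        also have "\<dots> \<le> 2 / real m"
          using cone_kernel_zero[OF m(1)] that unfolding J_def dist_real_def by fastforce
        finally have "dist x P < min d1 d2" using m(2) by linarith
        then have "x \<in> U" "dist x P < d2" using d1(2) by (auto simp: dist_commute)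
        then show ?thesis using d2(2)[of x] by (simp add: dist_real_def)
      qed
      have J: "integrable lborel J" "(LINT x|lborel. J x) = 2"
        using cone_kernel_integral[OF m(1)] by (simp_all add: J_def)
      have J0: "0 \<le> J x" for x unfolding J_def by (rule cone_kernel_nonneg)
      have meas: "f \<in> borel_measurable lborel"
      proof -
        have "(\<lambda>x. indicator U x *\<^sub>R (v x * J x)) \<in> borel_measurable borel"
          unfolding J_def
          by (intro borel_measurable_continuous_on_indicator continuous_on_mult v
              cone_kernel_continuous borel_open U)
        then show ?thesis by (simp add: f_def[abs_def])
      qed
      have diff: "\<bar>f x - v P * J x\<bar> \<le> e * J x" for x
      proof (cases "J x = 0")
        case False
        have "f x - v P * J x = (v x - v P) * J x" using near[OF False] by (simp add: f_def algebra_simps)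
        then show ?thesis using near[OF False] J0[of x] by (simp add: abs_mult mult_right_mono)
      qed (simp add: f_def)
      have "norm (f x) \<le> norm ((\<bar>v P\<bar> + e) * J x)" for x
      proof -
        have "\<bar>f x\<bar> \<le> \<bar>v P * J x\<bar> + e * J x" using diff[of x] by linarith
        then show ?thesis using e J0[of x] by (simp add: abs_mult algebra_simps)
      qed
      then have fI: "integrable lborel f"
        by (intro Bochner_Integration.integrable_bound[OF _ meas AE_I2, of "\<lambda>x. (\<bar>v P\<bar> + e) * J x"]) (use J(1) in auto)
      have "\<bar>(LINT x|lborel. f x) - 2 * v P\<bar> = \<bar>LINT x|lborel. f x - v P * J x\<bar>"
        using fI J by simp
      also have "\<dots> \<le> (LINT x|lborel. \<bar>f x - v P * J x\<bar>)"
        by (rule integral_abs_bound)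
      also have "\<dots> \<le> (LINT x|lborel. e * J x)"
        using fI J(1) diff by (intro integral_mono) auto
      also have "\<dots> = 2 * e" using J by simp
      finally show ?thesis using fI unfolding set_integrable_def set_lebesgue_integral_def f_def J_def by blast
    qed
    then show ?thesis by blast
  qed
  show "eventually (\<lambda>m. set_integrable lborel U (\<lambda>x. v x * cone_kernel H P (real m) x)) sequentially"
    using close[of 1] unfolding eventually_sequentially by force
  show "(\<lambda>m. LINT x:U|lborel. v x * cone_kernel H P (real m) x) \<longlonglongrightarrow> 2 * v P"
  proof (rule LIMSEQ_I)
    fix r :: real assume "0 < r"
    then obtain N where "\<forall>m\<ge>N. \<bar>(LINT x:U|lborel. v x * cone_kernel H P (real m) x) - 2 * v P\<bar> \<le> 2 * (r / 3)"
      using close[of "r / 3"] by auto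
    then show "\<exists>N. \<forall>m\<ge>N. norm ((LINT x:U|lborel. v x * cone_kernel H P (real m) x) - 2 * v P) < r"
      using \<open>0 < r\<close> by (intro exI[of _ N]) force
  qed
qed

end

lemma closed_back_cone_subset_Theta:
  assumes "P \<in> Theta R T" shows "closed_back_cone P \<subseteq> Theta R T"
proof
  fix x assume x: "x \<in> closed_back_cone P"
  then have "snd x \<le> snd P" by (auto simp: closed_back_cone_def)
  then have "ereal (snd x) \<le> ereal (snd P)" by simp
  also have "\<dots> < T" using assms by (simp add: Theta_iff)
  finally show "x \<in> Theta R T" using x assms by (auto simp: closed_back_cone_def Theta_iff)
qed

lemma back_cone_subset_Omega: "P \<in> Theta R T \<Longrightarrow> back_cone P \<subseteq> Omega R T"
  using closed_back_cone_subset_Theta[of P R T] back_cone_subset_closed_back_cone[of P]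
  by (auto simp: Theta_iff Omega_iff back_cone_def)

text \<open>This is the limit of \<open>weak_form_powr_weight\<close> for the test functions \<open>cone_test\<close>.\<close>

lemma dalembert_formula:
  assumes sol: "is_solution n R g \<psi> T u" and R: "0 < R" and P: "P \<in> Omega R T"
    and g: "continuous_on ({R<..} \<times> UNIV) g" and \<psi>: "continuous_on {R<..} \<psi>"
    and \<alpha>: "\<alpha> = (real n - 1) / 2"
  shows "2 * (fst P powr \<alpha> * u P) =
     (LINT r:{fst P - snd P<..<fst P + snd P}|lborel. r powr \<alpha> * \<psi> r)
     + (LINT x:back_cone P|lborel. fst x powr \<alpha> * g (fst x, u x)
          - \<alpha> * (\<alpha> - 1) / (fst x)\<^sup>2 * (fst x powr \<alpha> * u x))"
proof -
  obtain H where H: "smooth_step H" using smooth_step_exists by blast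
  have PT: "P \<in> Theta R T" using P Omega_subset_Theta by blast
  have \<xi>: "R < fst P - snd P" using P by (auto simp: Omega_iff)
  then have \<xi>0: "0 < fst P - snd P" using R by linarith
  have uc: "continuous_on (Theta R T) u" using sol by (simp add: is_solution_def)
  have pos: "R < fst x" "0 < fst x" if "x \<in> Theta R T" for x using that R by (auto simp: Theta_iff)
  have powc: "continuous_on (Theta R T) (\<lambda>x. fst x powr a)" for a
    by (intro continuous_on_powr continuous_intros) (use pos in fastforce)
  have gc: "continuous_on (Theta R T) (\<lambda>x. g (fst x, u x))"
    by (rule continuous_on_compose2[OF g]) (use pos in \<open>auto intro!: continuous_intros uc\<close>)
  \<comment> \<open>\<open>F1\<close> and \<open>F2\<close> come from the potential and from the nonlinearity.\<close>
  define v F1 F2 where "v x = fst x powr \<alpha> * u x" and "F1 x = \<alpha> * (\<alpha> - 1) * fst x powr (\<alpha> - 2) * u x"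
    and "F2 x = fst x powr \<alpha> * g (fst x, u x)" for x
  have vc: "continuous_on (Omega R T) v"
    unfolding v_def by (intro continuous_intros continuous_on_subset[OF powc Omega_subset_Theta]
        continuous_on_subset[OF uc Omega_subset_Theta])
  have "continuous_on (Theta R T) F1" "continuous_on (Theta R T) F2"
    unfolding F1_def F2_def by (intro continuous_intros powc uc gc)+
  then have Fc: "continuous_on (closed_back_cone P) F1" "continuous_on (closed_back_cone P) F2"
    using closed_back_cone_subset_Theta[OF PT] continuous_on_subset by blast+
  have hc: "continuous_on {fst P - snd P..fst P + snd P} (\<lambda>r. r powr \<alpha> * \<psi> r)"
    using \<xi> \<xi>0 by (intro continuous_intros continuous_on_powr continuous_on_subset[OF \<psi>]) auto
  have OU: "Omega R T \<subseteq> {x. 0 < snd x}" by (auto simp: Omega_iff)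
  define \<phi> where "\<phi> m = cone_test H P (real m)" for m
  \<comment> \<open>A compact triangle, cut off at a negative time, that supports all the test functions.\<close>
  define S where "S = {x. fst P - snd P \<le> fst x - snd x \<and> fst x + snd x \<le> fst P + snd P \<and> - ((fst P - snd P) / 2) \<le> snd x}"
  have Scl: "closed S" unfolding S_def by (intro closed_Collect_conj closed_Collect_le continuous_intros)
  have "S \<subseteq> cbox (0, - ((fst P - snd P) / 2)) (fst P + snd P + (fst P - snd P) / 2, snd P)"
  proof
    fix x assume "x \<in> S"
    then have "fst P - snd P \<le> fst x - snd x" "fst x + snd x \<le> fst P + snd P" "- ((fst P - snd P) / 2) \<le> snd x"
      by (simp_all add: S_def)
    moreover from this have "0 \<le> fst x" "fst x \<le> fst P + snd P + (fst P - snd P) / 2" "snd x \<le> snd P"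
      using \<xi>0 by (simp_all add: field_simps)
    ultimately show "x \<in> cbox (0, - ((fst P - snd P) / 2)) (fst P + snd P + (fst P - snd P) / 2, snd P)"
      unfolding cbox_Pair_eq by (simp add: mem_Times_iff)
  qed
  then have Sc: "compact S" using Scl bounded_cbox bounded_subset compact_eq_bounded_closed by blast
  have S0: "S \<subseteq> {x. 0 < fst x}"
  proof
    fix x assume "x \<in> S"
    then have "fst P - snd P \<le> fst x - snd x" "- ((fst P - snd P) / 2) \<le> snd x" by (simp_all add: S_def)
    then show "x \<in> {x. 0 < fst x}" using \<xi>0 by (simp add: field_simps)
  qed
  have ST: "S \<subseteq> Theta R T \<union> {(r, t). t < 0}"
  proof
    fix x assume x: "x \<in> S"
    show "x \<in> Theta R T \<union> {(r, t). t < 0}"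
    proof (cases "snd x < 0")
      case False
      then have "x \<in> closed_back_cone P" using x by (simp add: S_def closed_back_cone_def)
      then show ?thesis using closed_back_cone_subset_Theta[OF PT] by blast
    qed (simp add: case_prod_beta')
  qed
  note lim1 = cone_test_integral_limit[OF H \<xi>0 Fc(1) open_Omega back_cone_subset_Omega[OF PT] OU]
  note lim2 = cone_test_integral_limit[OF H \<xi>0 Fc(2) open_Omega back_cone_subset_Omega[OF PT] OU]
  note limk = cone_kernel_limit[OF H \<xi>0 open_Omega P vc]
  have "eventually (\<lambda>m. (LINT x:Omega R T|lborel. v x * cone_kernel H P (real m) x)
        + (LINT x:Omega R T|lborel. F1 x * cone_test H P (real m) x)
      = (LINT x:Omega R T|lborel. F2 x * cone_test H P (real m) x)
        + (LINT r:{R<..}|lborel. (r powr \<alpha> * \<psi> r) * cone_test H P (real m) (r, 0))) sequentially"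
    using limk(1)
  proof eventually_elim
    case (elim m)
    have "(LINT x:Omega R T|lborel. v x * cone_kernel H P (real m) x)
        + (LINT x:Omega R T|lborel. F1 x * cone_test H P (real m) x)
      = (LINT x:Omega R T|lborel. v x * cone_kernel H P (real m) x + F1 x * cone_test H P (real m) x)"
      using set_integral_add(2)[OF elim lim1(1)] by simp
    also have "\<dots> = (LINT x:Omega R T|lborel. u x * (fst x powr \<alpha> * (pd_t (pd_t (\<phi> m)) x - pd_r (pd_r (\<phi> m)) x)
            + \<alpha> * (\<alpha> - 1) * fst x powr (\<alpha> - 2) * \<phi> m x))"
      by (intro set_lebesgue_integral_cong)
        (use open_Omega \<xi>0 in \<open>auto simp: \<phi>_def v_def F1_def Omega_iff cone_test_wave_operator[OF H] algebra_simps\<close>)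
    also have "\<dots> = (LINT x:Omega R T|lborel. g (fst x, u x) * (fst x powr \<alpha> * \<phi> m x))
         + (LINT r:{R<..}|lborel. \<psi> r * (r powr \<alpha> * \<phi> m (r, 0)))"
    proof (rule weak_form_powr_weight[OF sol R H _ Sc _ ST S0 \<alpha>])
      show "smooth_plane (\<phi> m)" unfolding \<phi>_def by (rule smooth_plane_cone_test[OF H])
      show "\<phi> m x = 0" if "x \<notin> S" for x
        unfolding \<phi>_def by (rule cone_test_zero[OF H \<xi>0]) (use that in \<open>auto simp: S_def\<close>)
    qed
    also have "\<dots> = (LINT x:Omega R T|lborel. F2 x * cone_test H P (real m) x)
        + (LINT r:{R<..}|lborel. (r powr \<alpha> * \<psi> r) * cone_test H P (real m) (r, 0))"
      by (simp add: \<phi>_def F2_def ac_simps)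
    finally show ?case .
  qed
  moreover have "(\<lambda>m. (LINT x:Omega R T|lborel. v x * cone_kernel H P (real m) x)
        + (LINT x:Omega R T|lborel. F1 x * cone_test H P (real m) x))
      \<longlonglongrightarrow> 2 * v P + (LINT x:back_cone P|lborel. F1 x)"
    by (intro tendsto_add limk(2) lim1(2))
  moreover have "(\<lambda>m. (LINT x:Omega R T|lborel. F2 x * cone_test H P (real m) x)
        + (LINT r:{R<..}|lborel. (r powr \<alpha> * \<psi> r) * cone_test H P (real m) (r, 0)))
      \<longlonglongrightarrow> (LINT x:back_cone P|lborel. F2 x) + (LINT r:{fst P - snd P<..<fst P + snd P}|lborel. r powr \<alpha> * \<psi> r)"
    by (intro tendsto_add lim2(2) cone_test_initial_integral_limit[OF H \<xi>0 hc \<xi>])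
  ultimately have "2 * v P + (LINT x:back_cone P|lborel. F1 x)
      = (LINT x:back_cone P|lborel. F2 x) + (LINT r:{fst P - snd P<..<fst P + snd P}|lborel. r powr \<alpha> * \<psi> r)"
    using LIMSEQ_unique tendsto_cong by fast
  moreover have "(LINT x:back_cone P|lborel. F2 x) - (LINT x:back_cone P|lborel. F1 x)
      = (LINT x:back_cone P|lborel. F2 x - F1 x)"
  proof -
    have "P \<in> closed_back_cone P" using P by (simp add: closed_back_cone_def Omega_iff)
    then show ?thesis using set_integral_diff(2)[OF set_integrable_cone[OF Fc(2)] set_integrable_cone[OF Fc(1)]] by simp
  qed
  moreover have "(LINT x:back_cone P|lborel. F2 x - F1 x)
      = (LINT x:back_cone P|lborel. fst x powr \<alpha> * g (fst x, u x)
          - \<alpha> * (\<alpha> - 1) / (fst x)\<^sup>2 * (fst x powr \<alpha> * u x))"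
  proof (rule set_lebesgue_integral_cong)
    show "back_cone P \<in> sets lborel" using open_back_cone by simp
    show "\<forall>x. x \<in> back_cone P \<longrightarrow> F2 x - F1 x = fst x powr \<alpha> * g (fst x, u x)
          - \<alpha> * (\<alpha> - 1) / (fst x)\<^sup>2 * (fst x powr \<alpha> * u x)"
    proof (intro allI impI)
      fix x assume "x \<in> back_cone P"
      then have "x \<in> Theta R T" using closed_back_cone_subset_Theta[OF PT] back_cone_subset_closed_back_cone by blast
      then have "0 < fst x" by (rule pos)
      then show "F2 x - F1 x = fst x powr \<alpha> * g (fst x, u x)
          - \<alpha> * (\<alpha> - 1) / (fst x)\<^sup>2 * (fst x powr \<alpha> * u x)"
        by (simp add: F1_def F2_def powr_diff powr_numeral)
    qed
  qed
  ultimately show ?thesis unfolding v_def by linarith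
qed

section \<open>Comparison of solutions\<close>

text \<open>The conic region is a domain of dependence, since its boundary line \<open>r = \<beta> t\<close> is not steeper than the
  characteristics. So information on a solution in the region can be used on whole triangles.\<close>

lemma conic_region_closed_back_cone:
  assumes "0 \<le> snd P" "\<beta> * snd P < fst P" "1 \<le> \<beta>" "Q \<in> closed_back_cone P"
  shows "\<beta> * snd Q < fst Q"
proof -
  have "snd Q \<le> snd P" using assms(4) by (auto simp: closed_back_cone_def)
  then have "(\<beta> - 1) * snd Q \<le> (\<beta> - 1) * snd P" using assms(3) by (intro mult_left_mono) auto
  then show ?thesis using assms(2,4) by (auto simp: closed_back_cone_def algebra_simps)
qed

text \<open>\<open>cone_positivity\<close> for \<open>v = r\<^sup>\<alpha> w\<close>. The potential \<open>\<alpha>(\<alpha>-1) / r\<^sup>2\<close> is split into the nonnegative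
  \<open>\<kappa> / r\<^sup>2\<close> and the rest, which has the good sign and joins the nonlinearity in \<open>q\<close>. This is where \<open>\<beta>\<close> is
  chosen: \<open>r > \<beta> t\<close> implies \<open>r - t > (1 + \<kappa>) t\<close>, and \<open>(1 + \<kappa>)\<^sup>2 \<ge> \<kappa>\<close>.\<close>

lemma weighted_cone_positivity:
  fixes w F :: "real \<times> real \<Rightarrow> real"
  assumes R: "0 < R" and P: "0 \<le> snd P" "R < fst P - snd P"
    and \<beta>: "\<beta> = 2 + max 0 (\<alpha> * (\<alpha> - 1))" "\<beta> * snd P < fst P"
    and w: "continuous_on (closed_back_cone P) w" and w0: "\<And>r. R < r \<Longrightarrow> w (r, 0) = 0"
    and F: "continuous_on (closed_back_cone P) F"
    and h: "continuous_on {R<..} h" "\<And>r. R < r \<Longrightarrow> 0 \<le> h r"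
    and M: "0 \<le> M" "\<And>x. x \<in> closed_back_cone P \<Longrightarrow> - M * max 0 (- w x) \<le> F x"
    and rep: "\<And>Q. Q \<in> closed_back_cone P \<Longrightarrow> 0 < snd Q \<Longrightarrow> 2 * (fst Q powr \<alpha> * w Q) =
     (LINT r:{fst Q - snd Q<..<fst Q + snd Q}|lborel. r powr \<alpha> * h r)
     + (LINT x:back_cone Q|lborel. fst x powr \<alpha> * F x - \<alpha> * (\<alpha> - 1) / (fst x)\<^sup>2 * (fst x powr \<alpha> * w x))"
  shows "0 \<le> w P"
proof -
  define c where "c = \<alpha> * (\<alpha> - 1)"
  define \<kappa> where "\<kappa> = max 0 c"
  define v where "v x = fst x powr \<alpha> * w x" for x
  define q where "q x = fst x powr \<alpha> * F x + (\<kappa> - c) / (fst x)\<^sup>2 * v x" for x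
  define M' where "M' = M + (\<kappa> - c) / (fst P - snd P)\<^sup>2"
  have \<xi>: "0 < fst P - snd P" using R P by linarith
  have fstC: "fst P - snd P \<le> fst x" "0 < fst x" if "x \<in> closed_back_cone P" for x
    using that \<xi> by (auto simp: closed_back_cone_def)
  have \<kappa>: "0 \<le> \<kappa>" "0 \<le> \<kappa> - c" by (auto simp: \<kappa>_def)
  have powc: "continuous_on (closed_back_cone P) (\<lambda>x. fst x powr \<alpha>)"
    by (intro continuous_on_powr continuous_intros) (use fstC in fastforce)
  have vc: "continuous_on (closed_back_cone P) v"
    unfolding v_def by (intro continuous_on_mult powc w)
  have qc: "continuous_on (closed_back_cone P) q"
    unfolding q_def using fstC by (intro continuous_intros powc F vc) fastforce
  have "0 \<le> v P"
  proof (rule cone_positivity[OF \<xi> P(1) vc qc])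
    show "continuous_on {fst P - snd P..fst P + snd P} (\<lambda>r. r powr \<alpha> * h r)"
      using \<xi> P(2) by (intro continuous_intros continuous_on_powr continuous_on_subset[OF h(1)]) auto
    show "0 \<le> r powr \<alpha> * h r" if "r \<in> {fst P - snd P..fst P + snd P}" for r
      using h(2)[of r] that P(2) by simp
    show "0 \<le> \<kappa>" by (rule \<kappa>(1))
    show "\<kappa> * (snd P)\<^sup>2 \<le> (fst P - snd P)\<^sup>2"
    proof -
      have "(1 + \<kappa>) * snd P \<le> fst P - snd P"
        using \<beta> by (simp add: \<kappa>_def c_def algebra_simps)
      then have "((1 + \<kappa>) * snd P)\<^sup>2 \<le> (fst P - snd P)\<^sup>2"
        using \<kappa>(1) P(1) by (intro power_mono) auto
      moreover have "\<kappa> \<le> (1 + \<kappa>)\<^sup>2"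
        using \<kappa>(1) zero_le_power2[of \<kappa>] by (simp add: power2_sum)
      then have "\<kappa> * (snd P)\<^sup>2 \<le> (1 + \<kappa>)\<^sup>2 * (snd P)\<^sup>2" by (rule mult_right_mono) simp
      ultimately show ?thesis by (simp add: power_mult_distrib)
    qed
    show "0 \<le> M'" using M(1) \<kappa>(2) by (simp add: M'_def)
    show "- M' * max 0 (- v x) \<le> q x" if x: "x \<in> closed_back_cone P" for x
    proof -
      \<comment> \<open>The weight is positive, so it commutes with taking the negative part.\<close>
      have neg: "max 0 (- v x) = fst x powr \<alpha> * max 0 (- w x)"
        using fstC(2)[OF x] by (simp add: v_def max_mult_distrib_left[of "fst x powr \<alpha>"])
      have 1: "- (M * max 0 (- v x)) \<le> fst x powr \<alpha> * F x"
        using mult_left_mono[OF M(2)[OF x], of "fst x powr \<alpha>"] by (simp add: neg ac_simps)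
      have "(\<kappa> - c) / (fst x)\<^sup>2 \<le> (\<kappa> - c) / (fst P - snd P)\<^sup>2"
        using \<kappa>(2) \<xi> fstC[OF x] by (intro divide_left_mono mult_pos_pos zero_less_power power_mono) auto
      then have "(\<kappa> - c) / (fst x)\<^sup>2 * max 0 (- v x) \<le> (\<kappa> - c) / (fst P - snd P)\<^sup>2 * max 0 (- v x)"
        by (rule mult_right_mono) simp
      moreover have "- ((\<kappa> - c) / (fst x)\<^sup>2 * max 0 (- v x)) \<le> (\<kappa> - c) / (fst x)\<^sup>2 * v x"
      proof -
        have "(\<kappa> - c) / (fst x)\<^sup>2 * (- max 0 (- v x)) \<le> (\<kappa> - c) / (fst x)\<^sup>2 * v x"
          using \<kappa>(2) by (intro mult_left_mono) auto
        then show ?thesis by simp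
      qed
      ultimately have 2: "- ((\<kappa> - c) / (fst P - snd P)\<^sup>2 * max 0 (- v x)) \<le> (\<kappa> - c) / (fst x)\<^sup>2 * v x"
        by linarith
      have "- M' * max 0 (- v x) = - (M * max 0 (- v x)) + - ((\<kappa> - c) / (fst P - snd P)\<^sup>2 * max 0 (- v x))"
        by (simp add: M'_def algebra_simps)
      then show ?thesis unfolding q_def using add_mono[OF 1 2] by simp
    qed
    show "2 * v Q = (LINT r:{fst Q - snd Q<..<fst Q + snd Q}|lborel. r powr \<alpha> * h r)
        + (LINT x:back_cone Q|lborel. q x - \<kappa> / (fst x)\<^sup>2 * v x)" if Q: "Q \<in> closed_back_cone P" for Q
    proof (cases "0 < snd Q")
      case True
      have "q x - \<kappa> / (fst x)\<^sup>2 * v x = fst x powr \<alpha> * F x - \<alpha> * (\<alpha> - 1) / (fst x)\<^sup>2 * (fst x powr \<alpha> * w x)" for x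
        by (simp add: q_def v_def c_def diff_divide_distrib left_diff_distrib)
      then show ?thesis using rep[OF Q True] by (simp add: v_def)
    next
      case False
      then have "snd Q = 0" using Q by (auto simp: closed_back_cone_def)
      moreover have "R < fst Q" using Q P(2) \<open>snd Q = 0\<close> by (auto simp: closed_back_cone_def)
      then have "w Q = 0" using w0[of "fst Q"] \<open>snd Q = 0\<close> by (cases Q) simp
      moreover have "back_cone Q = {}" using \<open>snd Q = 0\<close> by (auto simp: back_cone_def)
      ultimately show ?thesis by (simp add: v_def set_lebesgue_integral_def)
    qed
  qed
  moreover have "0 < fst P powr \<alpha>" using \<xi> P(1) by simp
  ultimately show ?thesis by (simp add: v_def zero_le_mult_iff)
qed

text \<open>The mean value inequality on a box that contains both graphs over \<open>K\<close>. The box is convex and stays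
  inside \<open>r > R\<close> because of the bound \<open>a\<close>.\<close>

lemma C1_on_lipschitz_in_value:
  fixes g u u' :: "real \<times> real \<Rightarrow> real"
  assumes g: "C1_on g ({R<..} \<times> UNIV)" and K: "compact K" "\<And>x. x \<in> K \<Longrightarrow> a \<le> fst x" "R < a"
    and u: "continuous_on K u" "continuous_on K u'"
  obtains M where "0 \<le> M"
    and "\<And>x. x \<in> K \<Longrightarrow> \<bar>g (fst x, u x) - g (fst x, u' x)\<bar> \<le> M * \<bar>u x - u' x\<bar>"
proof -
  obtain g' where g': "\<And>x. x \<in> {R<..} \<times> UNIV \<Longrightarrow> (g has_derivative blinfun_apply (g' x)) (at x)"
    and gc: "continuous_on ({R<..} \<times> UNIV) g'"
    using g unfolding C1_on_def by blast
  have bnd: "\<exists>b. \<forall>x\<in>K. \<bar>f x\<bar> \<le> b" if "continuous_on K f" for f :: "real \<times> real \<Rightarrow> real"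
    using compact_imp_bounded[OF compact_continuous_image[OF that K(1)]] unfolding bounded_iff by simp
  obtain b where b: "\<And>x. x \<in> K \<Longrightarrow> \<bar>fst x\<bar> \<le> b" using bnd[OF continuous_on_fst[OF continuous_on_id]] by blast
  obtain c where c: "\<And>x. x \<in> K \<Longrightarrow> \<bar>u x\<bar> \<le> c" using bnd[OF u(1)] by blast
  obtain c' where c': "\<And>x. x \<in> K \<Longrightarrow> \<bar>u' x\<bar> \<le> c'" using bnd[OF u(2)] by blast
  define B where "B = cbox (a, - max c c') (b, max c c')"
  have B_eq: "B = {a..b} \<times> {- max c c'..max c c'}" unfolding B_def cbox_Pair_eq by simp
  have sub: "B \<subseteq> {R<..} \<times> UNIV" unfolding B_eq using K(3) by auto
  have "bounded (g' ` B)"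
    by (intro compact_imp_bounded compact_continuous_image continuous_on_subset[OF gc sub]) (simp add: B_def)
  then obtain M where M: "0 < M" "\<And>x. x \<in> B \<Longrightarrow> norm (g' x) \<le> M" unfolding bounded_pos by blast
  show ?thesis
  proof (rule that)
    show "0 \<le> M" using M(1) by simp
    fix x assume x: "x \<in> K"
    have xB: "(fst x, u x) \<in> B" "(fst x, u' x) \<in> B"
      unfolding B_eq using K(2)[OF x] b[OF x] c[OF x] c'[OF x] by auto
    have "norm (g (fst x, u x) - g (fst x, u' x)) \<le> M * norm ((fst x, u x) - (fst x, u' x))"
    proof (rule differentiable_bound[of B g "\<lambda>x. blinfun_apply (g' x)"])
      show "convex B" unfolding B_def by (rule convex_box)
      show "(g has_derivative blinfun_apply (g' y)) (at y within B)" if "y \<in> B" for y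
        by (rule has_derivative_at_withinI[OF g'[OF subsetD[OF sub that]]])
      show "onorm (blinfun_apply (g' y)) \<le> M" if "y \<in> B" for y
        using M(2)[OF that] by (simp add: norm_blinfun.rep_eq)
    qed (use xB in auto)
    then show "\<bar>g (fst x, u x) - g (fst x, u' x)\<bar> \<le> M * \<bar>u x - u' x\<bar>" by (simp add: norm_Pair)
  qed
qed

lemma C1_on_continuous:
  assumes "C1_on g A" shows "continuous_on A g"
proof -
  obtain g' where g': "\<And>x. x \<in> A \<Longrightarrow> (g has_derivative blinfun_apply (g' x)) (at x)"
    using assms unfolding C1_on_def by blast
  show ?thesis
    by (rule has_derivative_continuous_on[of A g "\<lambda>x. blinfun_apply (g' x)"])
      (rule has_derivative_at_withinI[OF g'])
qed

lemma nonlinearity_mono: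
  fixes g :: "real \<times> real \<Rightarrow> real"
  assumes g: "C1_on g ({R<..} \<times> UNIV)" and "R < r"
    and d: "\<And>v. 0 \<le> v \<Longrightarrow> 0 \<le> deriv (\<lambda>w. g (r, w)) v" and "0 \<le> a" "a \<le> b"
  shows "g (r, a) \<le> g (r, b)"
proof (rule DERIV_nonneg_imp_nondecreasing[OF \<open>a \<le> b\<close>])
  fix x assume x: "a \<le> x" "x \<le> b"
  obtain g' where g': "\<And>x. x \<in> {R<..} \<times> UNIV \<Longrightarrow> (g has_derivative blinfun_apply (g' x)) (at x)"
    using g unfolding C1_on_def by blast
  have "((\<lambda>w. (r, w)) has_derivative (\<lambda>w. (0, w))) (at x)"
    by (auto intro!: derivative_eq_intros)
  from has_derivative_compose[OF this g'[of "(r, x)"]] \<open>R < r\<close>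
  have "((\<lambda>w. g (r, w)) has_derivative (\<lambda>w. blinfun_apply (g' (r, x)) (0, w))) (at x)" by simp
  then have "(\<lambda>w. g (r, w)) differentiable (at x)" unfolding differentiable_def by blast
  then have "((\<lambda>w. g (r, w)) has_real_derivative deriv (\<lambda>w. g (r, w)) x) (at x)"
    using DERIV_deriv_iff_real_differentiable by blast
  then show "\<exists>y. ((\<lambda>w. g (r, w)) has_real_derivative y) (at x) \<and> 0 \<le> y"
    using d[of x] x \<open>0 \<le> a\<close> by (intro exI conjI) auto
qed

text \<open>Where \<open>u \<ge> 0\<close>, also \<open>g(r, u) \<ge> g(r, 0) = 0\<close>; where \<open>u < 0\<close>, the sign of \<open>g(r, u)\<close> is unknown, but
  the Lipschitz bound gives \<open>g(r, u) \<ge> - M \<bar>u\<bar>\<close>, which is all that the positivity argument asks for.\<close>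

lemma solution_nonneg:
  assumes sol: "is_solution n R g \<psi> T u" and R: "0 < R"
    and g: "C1_on g ({R<..} \<times> UNIV)" "\<And>r. R < r \<Longrightarrow> g (r, 0) = 0"
      "\<And>r v. R < r \<Longrightarrow> 0 \<le> v \<Longrightarrow> 0 \<le> deriv (\<lambda>w. g (r, w)) v"
    and \<psi>: "continuous_on {R<..} \<psi>" "\<And>r. R < r \<Longrightarrow> 0 \<le> \<psi> r"
    and \<alpha>: "\<alpha> = (real n - 1) / 2" and \<beta>: "\<beta> = 2 + max 0 (\<alpha> * (\<alpha> - 1))"
    and P: "P \<in> Theta R T" "\<beta> * snd P < fst P"
  shows "0 \<le> u P"
proof -
  have sub: "closed_back_cone P \<subseteq> Theta R T" by (rule closed_back_cone_subset_Theta[OF P(1)])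
  have uc: "continuous_on (closed_back_cone P) u"
    using sol sub continuous_on_subset unfolding is_solution_def by blast
  have P': "0 \<le> snd P" "R < fst P - snd P" using P(1) by (auto simp: Theta_iff)
  have fstC: "fst P - snd P \<le> fst x" "R < fst x" if "x \<in> closed_back_cone P" for x
    using that P' by (auto simp: closed_back_cone_def)
  obtain M where M: "0 \<le> M"
    "\<And>x. x \<in> closed_back_cone P \<Longrightarrow> \<bar>g (fst x, u x) - g (fst x, 0)\<bar> \<le> M * \<bar>u x - 0\<bar>"
    using C1_on_lipschitz_in_value[OF g(1) compact_closed_back_cone fstC(1) P'(2) uc continuous_on_const[of _ 0]]
    by metis
  show ?thesis
  proof (rule weighted_cone_positivity[OF R P' \<beta> P(2) uc _ _ \<psi> M(1)])
    show "u (r, 0) = 0" if "R < r" for r using sol that by (simp add: is_solution_def)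
    show "continuous_on (closed_back_cone P) (\<lambda>x. g (fst x, u x))"
      by (rule continuous_on_compose2[OF C1_on_continuous[OF g(1)]]) (use fstC uc in \<open>auto intro!: continuous_intros\<close>)
    show "- M * max 0 (- u x) \<le> g (fst x, u x)" if x: "x \<in> closed_back_cone P" for x
    proof (cases "0 \<le> u x")
      case True
      then have "g (fst x, 0) \<le> g (fst x, u x)"
        using nonlinearity_mono[OF g(1) fstC(2)[OF x] g(3)[OF fstC(2)[OF x]]] by simp
      then show ?thesis using True g(2)[OF fstC(2)[OF x]] by simp
    next
      case False
      then show ?thesis using M(2)[OF x] g(2)[OF fstC(2)[OF x]] by (auto simp: max_def)
    qed
    show "2 * (fst Q powr \<alpha> * u Q) =
     (LINT r:{fst Q - snd Q<..<fst Q + snd Q}|lborel. r powr \<alpha> * \<psi> r)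
     + (LINT x:back_cone Q|lborel. fst x powr \<alpha> * g (fst x, u x) - \<alpha> * (\<alpha> - 1) / (fst x)\<^sup>2 * (fst x powr \<alpha> * u x))"
      if "Q \<in> closed_back_cone P" "0 < snd Q" for Q
      using that sub by (intro dalembert_formula[OF sol R _ C1_on_continuous[OF g(1)] \<psi>(1) \<alpha>])
        (auto simp: Theta_iff Omega_iff)
  qed
qed

text \<open>The difference \<open>u - u'\<close> solves the same integral equation with the nonlinear term \<open>g(r, u) - g(r, u')\<close>.
  Monotonicity of \<open>g\<close> is available only for nonnegative arguments, so nonnegativity of both solutions on
  the triangle is needed first.\<close>

lemma solution_comparison:
  assumes sol: "is_solution n R g \<psi> T u" "is_solution n R g \<psi>' S u'" and R: "0 < R"
    and g: "C1_on g ({R<..} \<times> UNIV)" "\<And>r. R < r \<Longrightarrow> g (r, 0) = 0"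
      "\<And>r v. R < r \<Longrightarrow> 0 \<le> v \<Longrightarrow> 0 \<le> deriv (\<lambda>w. g (r, w)) v"
    and \<psi>: "continuous_on {R<..} \<psi>" "continuous_on {R<..} \<psi>'"
      "\<And>r. R < r \<Longrightarrow> \<psi>' r \<le> \<psi> r" "\<And>r. R < r \<Longrightarrow> 0 \<le> \<psi>' r"
    and \<alpha>: "\<alpha> = (real n - 1) / 2" and \<beta>: "\<beta> = 2 + max 0 (\<alpha> * (\<alpha> - 1))"
    and P: "P \<in> Theta R T" "P \<in> Theta R S" "\<beta> * snd P < fst P"
  shows "u' P \<le> u P"
proof -
  have sub: "closed_back_cone P \<subseteq> Theta R T" "closed_back_cone P \<subseteq> Theta R S"
    using closed_back_cone_subset_Theta P by blast+
  have uc: "continuous_on (closed_back_cone P) u" "continuous_on (closed_back_cone P) u'"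
    using sol sub continuous_on_subset unfolding is_solution_def by blast+
  have P': "0 \<le> snd P" "R < fst P - snd P" using P(1) by (auto simp: Theta_iff)
  have fstC: "fst P - snd P \<le> fst x" "R < fst x" if "x \<in> closed_back_cone P" for x
    using that P' by (auto simp: closed_back_cone_def)
  have \<psi>0: "0 \<le> \<psi> r" if "R < r" for r using \<psi>(3,4)[OF that] by linarith
  have nn: "0 \<le> u x" "0 \<le> u' x" if x: "x \<in> closed_back_cone P" for x
  proof -
    have "1 \<le> \<beta>" by (simp add: \<beta>)
    then have "\<beta> * snd x < fst x" using conic_region_closed_back_cone[OF P'(1) P(3) _ x] by blast
    then show "0 \<le> u x" "0 \<le> u' x"
      using solution_nonneg[OF sol(1) R g \<psi>(1) \<psi>0 \<alpha> \<beta>] solution_nonneg[OF sol(2) R g \<psi>(2,4) \<alpha> \<beta>]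
        sub x by blast+
  qed
  obtain M where M: "0 \<le> M"
    "\<And>x. x \<in> closed_back_cone P \<Longrightarrow> \<bar>g (fst x, u x) - g (fst x, u' x)\<bar> \<le> M * \<bar>u x - u' x\<bar>"
    using C1_on_lipschitz_in_value[OF g(1) compact_closed_back_cone fstC(1) P'(2) uc] by metis
  have gc: "continuous_on (closed_back_cone P) (\<lambda>x. g (fst x, u x))"
    "continuous_on (closed_back_cone P) (\<lambda>x. g (fst x, u' x))"
    by (rule continuous_on_compose2[OF C1_on_continuous[OF g(1)]];
        use fstC uc in \<open>auto intro!: continuous_intros\<close>)+
  have powc: "continuous_on (closed_back_cone P) (\<lambda>x. fst x powr \<alpha>)"
    by (intro continuous_on_powr continuous_intros) (use fstC R in fastforce)
  have dw: "continuous_on (closed_back_cone P) (\<lambda>x. u x - u' x)"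
    and dg: "continuous_on (closed_back_cone P) (\<lambda>x. g (fst x, u x) - g (fst x, u' x))"
    and d\<psi>: "continuous_on {R<..} (\<lambda>r. \<psi> r - \<psi>' r)" "\<And>r. R < r \<Longrightarrow> 0 \<le> \<psi> r - \<psi>' r"
    using uc gc \<psi> by (auto intro!: continuous_intros)
  have "0 \<le> (\<lambda>x. u x - u' x) P"
  proof (rule weighted_cone_positivity[OF R P' \<beta> P(3) dw _ dg d\<psi> M(1)])
    show "u (r, 0) - u' (r, 0) = 0" if "R < r" for r using sol that by (simp add: is_solution_def)
    show "- M * max 0 (- (u x - u' x)) \<le> g (fst x, u x) - g (fst x, u' x)" if x: "x \<in> closed_back_cone P" for x
    proof (cases "u' x \<le> u x")
      case True
      then have "g (fst x, u' x) \<le> g (fst x, u x)"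
        using nonlinearity_mono[OF g(1) fstC(2)[OF x] g(3)[OF fstC(2)[OF x]]] nn(2)[OF x] by simp
      then show ?thesis using True by simp
    next
      case False
      then show ?thesis using M(2)[OF x] by (auto simp: max_def)
    qed
    fix Q assume Q: "Q \<in> closed_back_cone P" "0 < snd Q"
    define I where "I = {fst Q - snd Q<..<fst Q + snd Q}"
    define a where "a \<psi> = (\<lambda>r. r powr \<alpha> * \<psi> r)" for \<psi> :: "real \<Rightarrow> real"
    define f where "f u = (\<lambda>x. fst x powr \<alpha> * g (fst x, u x) - \<alpha> * (\<alpha> - 1) / (fst x)\<^sup>2 * (fst x powr \<alpha> * u x))"
      for u :: "real \<times> real \<Rightarrow> real"
    have "2 * (fst Q powr \<alpha> * u Q) = (LINT r:I|lborel. a \<psi> r) + (LINT x:back_cone Q|lborel. f u x)"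
      "2 * (fst Q powr \<alpha> * u' Q) = (LINT r:I|lborel. a \<psi>' r) + (LINT x:back_cone Q|lborel. f u' x)"
      unfolding I_def a_def f_def
      using Q sub by (intro dalembert_formula[OF sol(1) R _ C1_on_continuous[OF g(1)] \<psi>(1) \<alpha>]
          dalembert_formula[OF sol(2) R _ C1_on_continuous[OF g(1)] \<psi>(2) \<alpha>]; auto simp: Theta_iff Omega_iff)+
    moreover have "set_integrable lborel I (a \<psi>)" "set_integrable lborel I (a \<psi>')"
    proof -
      have "set_integrable lborel I (a h)" if "continuous_on {R<..} h" for h
      proof (rule set_integrable_subset)
        have "R < fst Q - snd Q" using Q P'(2) by (auto simp: closed_back_cone_def)
        then have "continuous_on {fst Q - snd Q..fst Q + snd Q} (a h)"
          unfolding a_def using R by (intro continuous_intros continuous_on_powr continuous_on_subset[OF that]) auto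
        then show "set_integrable lborel {fst Q - snd Q..fst Q + snd Q} (a h)"
          unfolding set_integrable_def by (rule borel_integrable_compact[OF compact_Icc])
      qed (auto simp: I_def)
      then show "set_integrable lborel I (a \<psi>)" "set_integrable lborel I (a \<psi>')" using \<psi> by blast+
    qed
    from set_integral_diff(2)[OF this]
    have "(LINT r:I|lborel. a (\<lambda>r. \<psi> r - \<psi>' r) r) = (LINT r:I|lborel. a \<psi> r) - (LINT r:I|lborel. a \<psi>' r)"
      by (simp add: a_def right_diff_distrib)
    moreover have "set_integrable lborel (back_cone Q) (f u)" "set_integrable lborel (back_cone Q) (f u')"
    proof -
      have "continuous_on (closed_back_cone P) (f u)" "continuous_on (closed_back_cone P) (f u')"
        unfolding f_def using fstC R by (intro continuous_intros gc powc uc; fastforce)+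
      then show "set_integrable lborel (back_cone Q) (f u)" "set_integrable lborel (back_cone Q) (f u')"
        using set_integrable_cone Q(1) by blast+
    qed
    from set_integral_diff(2)[OF this]
    have "(LINT x:back_cone Q|lborel. fst x powr \<alpha> * (g (fst x, u x) - g (fst x, u' x))
          - \<alpha> * (\<alpha> - 1) / (fst x)\<^sup>2 * (fst x powr \<alpha> * (u x - u' x)))
        = (LINT x:back_cone Q|lborel. f u x) - (LINT x:back_cone Q|lborel. f u' x)"
      by (simp add: f_def algebra_simps)
    ultimately show "2 * (fst Q powr \<alpha> * (u Q - u' Q)) =
     (LINT r:{fst Q - snd Q<..<fst Q + snd Q}|lborel. r powr \<alpha> * (\<psi> r - \<psi>' r))
     + (LINT x:back_cone Q|lborel. fst x powr \<alpha> * (g (fst x, u x) - g (fst x, u' x))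
          - \<alpha> * (\<alpha> - 1) / (fst x)\<^sup>2 * (fst x powr \<alpha> * (u x - u' x)))"
      unfolding I_def a_def by (simp add: right_diff_distrib)
  qed
  then show ?thesis by simp
qed

theorem lemma5p4:
  fixes n :: nat
  assumes "n \<ge> 1"
  shows "\<exists>\<beta>>1. \<forall>(R::real) (g :: real \<times> real \<Rightarrow> real) (\<psi> :: real \<Rightarrow> real) (\<psi>' :: real \<Rightarrow> real)
            (u :: real \<times> real \<Rightarrow> real) (u' :: real \<times> real \<Rightarrow> real) (T::ereal) (S::ereal).
      R > 0 \<longrightarrow>
      C1_on g ({R<..} \<times> UNIV) \<longrightarrow>
      (\<forall>r>R. g (r, 0) = 0) \<longrightarrow>
      (\<forall>r>R. \<forall>v\<ge>0. deriv (\<lambda>w. g (r, w)) v \<ge> 0) \<longrightarrow>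
      continuous_on {R<..} \<psi> \<longrightarrow> continuous_on {R<..} \<psi>' \<longrightarrow>
      (\<forall>r>R. \<psi> r \<ge> \<psi>' r \<and> \<psi>' r \<ge> 0) \<longrightarrow>
      T = lifespan n R g \<psi> \<longrightarrow> is_solution n R g \<psi> T u \<longrightarrow>
      is_solution n R g \<psi>' S u' \<longrightarrow>
      (\<forall>(r, t) \<in> Theta' \<beta> R T. ereal t < S \<longrightarrow> u (r, t) \<ge> u' (r, t) \<and> u' (r, t) \<ge> 0)"
proof -
  define \<alpha> where "\<alpha> = (real n - 1) / 2"
  define \<beta> where "\<beta> = 2 + max 0 (\<alpha> * (\<alpha> - 1))"
  show ?thesis
  proof (intro exI[of _ \<beta>] conjI allI impI ballI)
    show "1 < \<beta>" by (simp add: \<beta>_def)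
    fix R :: real and g :: "real \<times> real \<Rightarrow> real" and \<psi> \<psi>' :: "real \<Rightarrow> real"
      and u u' :: "real \<times> real \<Rightarrow> real" and T S :: ereal and P :: "real \<times> real"
    assume R: "R > 0" and g: "C1_on g ({R<..} \<times> UNIV)" "\<forall>r>R. g (r, 0) = 0"
      "\<forall>r>R. \<forall>v\<ge>0. deriv (\<lambda>w. g (r, w)) v \<ge> 0"
      and \<psi>: "continuous_on {R<..} \<psi>" "continuous_on {R<..} \<psi>'" "\<forall>r>R. \<psi> r \<ge> \<psi>' r \<and> \<psi>' r \<ge> 0"
      and sol: "is_solution n R g \<psi> T u" "is_solution n R g \<psi>' S u'" and P: "P \<in> Theta' \<beta> R T"
    show "case P of (r, t) \<Rightarrow> ereal t < S \<longrightarrow> u (r, t) \<ge> u' (r, t) \<and> u' (r, t) \<ge> 0"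
    proof (clarify, intro conjI)
      fix r t assume rt: "P = (r, t)" and tS: "ereal t < S"
      have PT: "(r, t) \<in> Theta R T" "(r, t) \<in> Theta R S" "\<beta> * snd (r, t) < fst (r, t)"
        using P tS by (auto simp: rt Theta'_def Theta_def)
      show "u (r, t) \<ge> u' (r, t)"
        by (rule solution_comparison[OF sol R g(1) _ _ \<psi>(1,2) _ _ \<alpha>_def \<beta>_def PT]) (use g \<psi> in auto)
      show "u' (r, t) \<ge> 0"
        by (rule solution_nonneg[OF sol(2) R g(1) _ _ \<psi>(2) _ \<alpha>_def \<beta>_def PT(2,3)]) (use g \<psi> in auto)
    qed
  qed
qed

end
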